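(* The Andrews-Curtis group $\mathrm{AC}(F_2)$ of the free group $F_2$ of rank $2$ is not finitely presentable.
   Context: For a group $G$ and $g, f \in G$ write $g^f = fgf^{-1}$. For $r \ge 2$, the elementary AC-moves on the set $G^r$ of $r$-tuples of elements of $G$ are the following bijections (each changes only the $i$-th component, $1 \le i \le r$): - $R_{ij}^{\pm 1}$ ($i \neq j$): replaces $u_i$ by $u_i u_j^{\pm 1}$; - $L_{ij}^{\pm 1}$ ($i \neq j$): replaces $u_i$ by $u_j^{\pm 1} u_i$; - $I_i$: replaces $u_i$ by $u_i^{-1}$; - $C_{i,w}$ ($w \in G$): replaces $u_i$ by $u_i^{w}$. $\mathrm{NGen}_r(G) \subseteq G^r$ is the set of all $r$-tuples whose normal closure is $G$; it is invariant under all elementary AC-moves. $\mathrm{AC}_r(G)$ is the subgroup of the symmetric group $\mathrm{Sym}(\mathrm{NGen}_r(G))$ generated by the restrictions of the elementary AC-moves to $\mathrm{NGen}_r(G)$. For a free group $F_r$ of rank $r$, $\mathrm{AC}(F_r) = \mathrm{AC}_r(F_r)$. *)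

theory Defs
  imports "HOL-Algebra.Bij" "HOL-Algebra.Generated_Groups"
begin

section \<open>Free groups\<close>

text \<open>
  The free group on \<open>X\<close>, realised on reduced words. The letter \<open>(True, x)\<close> stands for the
  generator \<open>x\<close> and \<open>(False, x)\<close> for its inverse.
\<close>

type_synonym 'a word = "(bool \<times> 'a) list"

definition inv_letter :: "bool \<times> 'a \<Rightarrow> bool \<times> 'a" where
  "inv_letter a = (\<not> fst a, snd a)"

definition reduced :: "'a word \<Rightarrow> bool" where
  "reduced w \<longleftrightarrow> successively (\<lambda>a b. b \<noteq> inv_letter a) w"

fun push :: "bool \<times> 'a \<Rightarrow> 'a word \<Rightarrow> 'a word" where
  "push a [] = [a]"
| "push a (b # w) = (if b = inv_letter a then w else a # b # w)"

definition free_group :: "'a set \<Rightarrow> 'a word monoid" where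
  "free_group X =
    \<lparr>carrier = {w. set w \<subseteq> UNIV \<times> X \<and> reduced w},
     mult = foldr push,
     one = []\<rparr>"

lemma inv_letter_inv_letter [simp]: "inv_letter (inv_letter a) = a"
  by (simp add: inv_letter_def)

lemma inv_letter_neq [simp]: "inv_letter a \<noteq> a" "a \<noteq> inv_letter a"
  by (auto simp: inv_letter_def prod_eq_iff)

lemma inv_letter_in: "a \<in> UNIV \<times> X \<Longrightarrow> inv_letter a \<in> UNIV \<times> X"
  by (auto simp: inv_letter_def)

lemma reduced_Nil [simp]: "reduced []"
  by (simp add: reduced_def)

lemma reduced_single [simp]: "reduced [a]"
  by (simp add: reduced_def)

lemma reduced_Cons: "reduced (a # w) \<longleftrightarrow> reduced w \<and> (w = [] \<or> hd w \<noteq> inv_letter a)"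
  by (cases w) (auto simp: reduced_def)

lemma reduced_push: "reduced w \<Longrightarrow> reduced (push a w)"
  by (cases w) (auto simp: reduced_Cons)

lemma set_push: "set (push a w) \<subseteq> insert a (set w)"
  by (cases w) auto

lemma push_inv_letter: "reduced w \<Longrightarrow> push a (push (inv_letter a) w) = w"
proof (cases w)
  case (Cons b v)
  then show "reduced w \<Longrightarrow> push a (push (inv_letter a) w) = w"
    by (cases v) (auto simp: reduced_Cons)
qed simp

lemma push_reduced: "reduced (a # w) \<Longrightarrow> push a w = a # w"
  by (cases w) (auto simp: reduced_Cons)

lemma reduced_foldr_push: "reduced v \<Longrightarrow> reduced (foldr push u v)"
  by (induction u) (auto intro: reduced_push)

lemma set_foldr_push: "set (foldr push u v) \<subseteq> set u \<union> set v"
  by (induction u) (use set_push in fastforce)+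

lemma foldr_push_Nil: "reduced u \<Longrightarrow> foldr push u [] = u"
  by (induction u) (auto simp: push_reduced reduced_Cons)

lemma foldr_push_push:
  assumes "reduced w" shows "foldr push (push a v) w = push a (foldr push v w)"
proof (cases v)
  case (Cons b v')
  then show ?thesis
    using push_inv_letter[of "foldr push v' w" a] reduced_foldr_push[OF assms] by auto
qed auto

lemma foldr_push_assoc:
  "reduced w \<Longrightarrow> foldr push (foldr push u v) w = foldr push u (foldr push v w)"
  by (induction u) (auto simp: foldr_push_push)

lemma foldr_push_inv: "foldr push (rev (map inv_letter u)) u = []"
  by (induction u) auto

lemma group_free_group: "group (free_group X)"
proof (rule groupI)
  fix u assume u: "u \<in> carrier (free_group X)"
  define v where "v = foldr push (rev (map inv_letter u)) []"
  have "set v \<subseteq> inv_letter ` set u"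
    using set_foldr_push[of "rev (map inv_letter u)" "[]"] by (simp add: v_def)
  also have "\<dots> \<subseteq> UNIV \<times> X"
    using u by (auto simp: free_group_def inv_letter_def)
  finally have "set v \<subseteq> UNIV \<times> X" .
  moreover have "reduced v"
    by (simp add: v_def reduced_foldr_push)
  moreover have "foldr push v u = []"
    using u by (simp add: v_def free_group_def foldr_push_assoc foldr_push_inv)
  ultimately show "\<exists>v\<in>carrier (free_group X). v \<otimes>\<^bsub>free_group X\<^esub> u = \<one>\<^bsub>free_group X\<^esub>"
    by (auto simp: free_group_def)
next
  fix u v assume "u \<in> carrier (free_group X)" "v \<in> carrier (free_group X)"
  then show "u \<otimes>\<^bsub>free_group X\<^esub> v \<in> carrier (free_group X)"
    using set_foldr_push[of u v] by (auto simp: free_group_def reduced_foldr_push)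
qed (auto simp: free_group_def foldr_push_assoc)

definition free_lift :: "('b, 'c) monoid_scheme \<Rightarrow> ('a \<Rightarrow> 'b) \<Rightarrow> 'a word \<Rightarrow> 'b" where
  "free_lift H f w =
    foldr (\<lambda>(s, x) h. (if s then f x else inv\<^bsub>H\<^esub> f x) \<otimes>\<^bsub>H\<^esub> h) w \<one>\<^bsub>H\<^esub>"

lemma free_group_universal:
  fixes H (structure)
  assumes "group H" and f: "\<And>x. x \<in> X \<Longrightarrow> f x \<in> carrier H"
  shows "free_lift H f \<in> hom (free_group X) H"
    and "\<And>x. x \<in> X \<Longrightarrow> free_lift H f [(True, x)] = f x"
    and "\<And>h w. h \<in> hom (free_group X) H \<Longrightarrow> (\<And>x. x \<in> X \<Longrightarrow> h [(True, x)] = f x) \<Longrightarrow>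
           w \<in> carrier (free_group X) \<Longrightarrow> h w = free_lift H f w"
proof -
  interpret group H by fact
  define l where "l = (\<lambda>(s, x). if s then f x else inv f x)"
  have Nil: "free_lift H f [] = \<one>" and Cons: "free_lift H f (a # w) = l a \<otimes> free_lift H f w" for a w
    by (auto simp: free_lift_def l_def split: prod.splits)
  have l: "l a \<in> carrier H" if "a \<in> UNIV \<times> X" for a
    using that f by (auto simp: l_def)
  have linv: "l (inv_letter a) = inv (l a)" if "a \<in> UNIV \<times> X" for a
    using that f by (auto simp: l_def inv_letter_def)
  have closed: "free_lift H f w \<in> carrier H" if "set w \<subseteq> UNIV \<times> X" for w
    using that by (induction w) (auto simp: Nil Cons intro!: m_closed l)
  have push: "free_lift H f (push a w) = l a \<otimes> free_lift H f w"
    if "a \<in> UNIV \<times> X" "set w \<subseteq> UNIV \<times> X" for a w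
  proof (cases "\<exists>v. w = inv_letter a # v")
    case True
    then obtain v where w: "w = inv_letter a # v" by blast
    have "l a \<otimes> (inv (l a) \<otimes> free_lift H f v) = free_lift H f v"
      using that w l closed by (simp flip: m_assoc)
    then show ?thesis
      using that w by (simp add: Cons linv)
  next
    case False
    then show ?thesis by (cases w) (auto simp: Cons)
  qed
  have mult: "free_lift H f (foldr push u v) = free_lift H f u \<otimes> free_lift H f v"
    if "set u \<subseteq> UNIV \<times> X" "set v \<subseteq> UNIV \<times> X" for u v
    using that
  proof (induction u)
    case (Cons a u)
    then have "set (foldr push u v) \<subseteq> UNIV \<times> X"
      using set_foldr_push[of u v] by auto
    with Cons show ?case
      by (simp add: push push.simps \<open>\<And>a w. free_lift H f (a # w) = _\<close> l closed m_assoc)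
  qed (simp add: Nil closed)
  show "free_lift H f \<in> hom (free_group X) H"
    by (rule homI) (auto simp: free_group_def closed mult)
  show gen: "free_lift H f [(True, x)] = f x" if "x \<in> X" for x
    using f[OF that] by (simp add: free_lift_def)
  fix h w assume h: "h \<in> hom (free_group X) H" and hf: "\<And>x. x \<in> X \<Longrightarrow> h [(True, x)] = f x"
    and w: "w \<in> carrier (free_group X)"
  interpret h: group_hom "free_group X" H h
    using h by (simp add: group_hom_def group_hom_axioms_def group_free_group \<open>group H\<close>)
  have single: "[a] \<in> carrier (free_group X)" if "a \<in> UNIV \<times> X" for a
    using that by (auto simp: free_group_def)
  have hl: "h [a] = l a" if a: "a \<in> UNIV \<times> X" for a
  proof -
    obtain s x where sx: "a = (s, x)" and x: "x \<in> X" using a by auto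
    have "[(False, x)] \<otimes>\<^bsub>free_group X\<^esub> [(True, x)] = \<one>\<^bsub>free_group X\<^esub>"
      by (simp add: free_group_def inv_letter_def)
    then have "h [(False, x)] \<otimes> h [(True, x)] = \<one>"
      using single x by (metis SigmaI UNIV_I h.hom_mult h.hom_one)
    then have "h [(False, x)] = inv f x"
      using hf[OF x] single x by (metis SigmaI UNIV_I h.hom_closed inv_equality)
    then show ?thesis using hf[OF x] sx by (auto simp: l_def)
  qed
  show "h w = free_lift H f w"
    using w
  proof (induction w)
    case Nil
    then show ?case using h.hom_one by (simp add: free_group_def \<open>free_lift H f [] = \<one>\<close>)
  next
    case (Cons a w)
    then have a: "a \<in> UNIV \<times> X" and w: "w \<in> carrier (free_group X)" and "reduced (a # w)"
      by (auto simp: free_group_def reduced_Cons)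
    then have "a # w = [a] \<otimes>\<^bsub>free_group X\<^esub> w"
      by (simp add: free_group_def push_reduced)
    then have "h (a # w) = h [a] \<otimes> h w"
      using single[OF a] w h.hom_mult by metis
    then show ?case
      using Cons.IH[OF w] hl[OF a] by (simp add: \<open>\<And>a w. free_lift H f (a # w) = _\<close>)
  qed
qed

section \<open>Normal closures and finite presentability\<close>

definition normal_closure :: "('a, 'b) monoid_scheme \<Rightarrow> 'a set \<Rightarrow> 'a set" where
  "normal_closure G S = \<Inter>{N. N \<lhd> G \<and> S \<subseteq> N}"

lemma (in group) normal_carrier: "carrier G \<lhd> G"
  by (simp add: normal_inv_iff subgroup_self)

lemma (in group) normal_closure_normal:
  assumes "S \<subseteq> carrier G" shows "normal_closure G S \<lhd> G"
proof -
  have "subgroup (\<Inter>{N. N \<lhd> G \<and> S \<subseteq> N}) G"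
    using normal_carrier assms by (intro subgroups_Inter) (auto simp: normal_inv_iff)
  then show ?thesis
    unfolding normal_closure_def by (auto simp: normal_inv_iff)
qed

definition finitely_presentable :: "('a, 'b) monoid_scheme \<Rightarrow> bool" where
  "finitely_presentable G \<longleftrightarrow>
    (\<exists>(X :: nat set) R. finite X \<and> finite R \<and> R \<subseteq> carrier (free_group X) \<and>
       free_group X Mod normal_closure (free_group X) R \<cong> G)"

section \<open>Andrews-Curtis groups\<close>

definition tuples :: "nat \<Rightarrow> ('a, 'b) monoid_scheme \<Rightarrow> (nat \<Rightarrow> 'a) set" where
  "tuples r G = {1..r} \<rightarrow>\<^sub>E carrier G"

definition NGen :: "nat \<Rightarrow> ('a, 'b) monoid_scheme \<Rightarrow> (nat \<Rightarrow> 'a) set" where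
  "NGen r G = {u \<in> tuples r G. normal_closure G (u ` {1..r}) = carrier G}"

definition move_R ::
    "('a, 'b) monoid_scheme \<Rightarrow> nat \<Rightarrow> nat \<Rightarrow> int \<Rightarrow> (nat \<Rightarrow> 'a) \<Rightarrow> (nat \<Rightarrow> 'a)" where
  "move_R G i j e u = u(i := u i \<otimes>\<^bsub>G\<^esub> u j [^]\<^bsub>G\<^esub> e)"

definition move_L ::
    "('a, 'b) monoid_scheme \<Rightarrow> nat \<Rightarrow> nat \<Rightarrow> int \<Rightarrow> (nat \<Rightarrow> 'a) \<Rightarrow> (nat \<Rightarrow> 'a)" where
  "move_L G i j e u = u(i := u j [^]\<^bsub>G\<^esub> e \<otimes>\<^bsub>G\<^esub> u i)"

definition move_I :: "('a, 'b) monoid_scheme \<Rightarrow> nat \<Rightarrow> (nat \<Rightarrow> 'a) \<Rightarrow> (nat \<Rightarrow> 'a)" where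
  "move_I G i u = u(i := inv\<^bsub>G\<^esub> u i)"

definition move_C :: "('a, 'b) monoid_scheme \<Rightarrow> nat \<Rightarrow> 'a \<Rightarrow> (nat \<Rightarrow> 'a) \<Rightarrow> (nat \<Rightarrow> 'a)" where
  "move_C G i w u = u(i := w \<otimes>\<^bsub>G\<^esub> u i \<otimes>\<^bsub>G\<^esub> inv\<^bsub>G\<^esub> w)"

definition AC_moves ::
    "nat \<Rightarrow> ('a, 'b) monoid_scheme \<Rightarrow> ((nat \<Rightarrow> 'a) \<Rightarrow> (nat \<Rightarrow> 'a)) set" where
  "AC_moves r G =
     {move_R G i j e | i j e. i \<in> {1..r} \<and> j \<in> {1..r} \<and> i \<noteq> j \<and> e \<in> {1, -1}} \<union>
     {move_L G i j e | i j e. i \<in> {1..r} \<and> j \<in> {1..r} \<and> i \<noteq> j \<and> e \<in> {1, -1}} \<union>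
     {move_I G i | i. i \<in> {1..r}} \<union>
     {move_C G i w | i w. i \<in> {1..r} \<and> w \<in> carrier G}"

definition AC_group ::
    "nat \<Rightarrow> ('a, 'b) monoid_scheme \<Rightarrow> ((nat \<Rightarrow> 'a) \<Rightarrow> (nat \<Rightarrow> 'a)) monoid" where
  "AC_group r G =
     subgroup_generated (BijGroup (NGen r G)) ((\<lambda>m. restrict m (NGen r G)) ` AC_moves r G)"

text \<open>
  \<open>subgroup_generated\<close> silently drops generators outside the carrier; the lemma
  \<open>AC_moves_Bij\<close> shows that nothing is dropped here.
\<close>

lemma (in group) AC_moves_normal:
  assumes m: "m \<in> AC_moves r G" and N: "N \<lhd> G" and u: "u \<in> {1..r} \<rightarrow>\<^sub>E N"
  shows "m u \<in> {1..r} \<rightarrow>\<^sub>E N"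
proof -
  interpret N: normal N G by fact
  have uN: "u i \<in> N" if "i \<in> {1..r}" for i using u that by auto
  have upd: "u(i := x) \<in> {1..r} \<rightarrow>\<^sub>E N" if "i \<in> {1..r}" "x \<in> N" for i x
    using u that by (auto simp: PiE_iff extensional_def)
  have pow: "u j [^] e \<in> N" if "j \<in> {1..r}" "e \<in> {1, -1}" for j and e :: int
    using that uN[OF that(1)] N.mem_carrier[OF uN[OF that(1)]]
    by (auto simp: int_pow_neg int_pow_1)
  show ?thesis
    using m unfolding AC_moves_def move_R_def move_L_def move_I_def move_C_def
    by (auto intro!: upd N.m_closed N.m_inv_closed N.inv_op_closed2 simp: uN pow PiE_arb[OF u]
        simp del: atLeastAtMost_iff One_nat_def)
qed

lemma (in group) AC_moves_inverse:
  assumes m: "m \<in> AC_moves r G"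
  obtains m' where "m' \<in> AC_moves r G"
    "\<And>u. u \<in> tuples r G \<Longrightarrow> m' (m u) = u" "\<And>u. u \<in> tuples r G \<Longrightarrow> m (m' u) = u"
proof -
  have uG: "u i \<in> carrier G" if "u \<in> tuples r G" "i \<in> {1..r}" for u i
    using that by (auto simp: tuples_def)
  have e: "- e \<in> {1, -1}" if "e \<in> {1, -1}" for e :: int
    using that by auto
  have cancel: "inv x \<otimes> (x \<otimes> y) = y" "x \<otimes> (inv x \<otimes> y) = y"
    if "x \<in> carrier G" "y \<in> carrier G" for x y
    using that by (simp_all flip: m_assoc)
  consider
      (R) i j e where "m = move_R G i j e" "i \<in> {1..r}" "j \<in> {1..r}" "i \<noteq> j" "e \<in> {1, -1}"
    | (L) i j e where "m = move_L G i j e" "i \<in> {1..r}" "j \<in> {1..r}" "i \<noteq> j" "e \<in> {1, -1}"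
    | (I) i where "m = move_I G i" "i \<in> {1..r}"
    | (C) i w where "m = move_C G i w" "i \<in> {1..r}" "w \<in> carrier G"
    using m unfolding AC_moves_def by blast
  then show thesis
  proof cases
    case R
    show thesis
    proof (rule that[of "move_R G i j (- e)"])
      show "move_R G i j (- e) \<in> AC_moves r G"
        using R(2-4) e[OF R(5)] unfolding AC_moves_def by blast
    qed (use R uG in \<open>auto simp: move_R_def m_assoc int_pow_neg simp del: atLeastAtMost_iff\<close>)
  next
    case L
    show thesis
    proof (rule that[of "move_L G i j (- e)"])
      show "move_L G i j (- e) \<in> AC_moves r G"
        using L(2-4) e[OF L(5)] unfolding AC_moves_def by blast
    qed (use L uG in \<open>auto simp: move_L_def int_pow_neg cancel simp del: atLeastAtMost_iff\<close>)
  next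
    case I
    show thesis
      by (rule that[of m]) (use m I uG in \<open>auto simp: move_I_def simp del: atLeastAtMost_iff\<close>)
  next
    case C
    have conj: "inv w \<otimes> (w \<otimes> x \<otimes> inv w) \<otimes> w = x" "w \<otimes> (inv w \<otimes> x \<otimes> w) \<otimes> inv w = x"
      if "x \<in> carrier G" for x
      using that C(3) by (simp_all add: m_assoc cancel)
    show thesis
    proof (rule that[of "move_C G i (inv w)"])
      show "move_C G i (inv w) \<in> AC_moves r G"
        using C(2) inv_closed[OF C(3)] unfolding AC_moves_def by blast
    qed (use C uG conj in \<open>auto simp: move_C_def simp del: atLeastAtMost_iff\<close>)
  qed
qed

lemma (in group) AC_moves_NGen:
  assumes m: "m \<in> AC_moves r G" and u: "u \<in> NGen r G"
  shows "m u \<in> NGen r G"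
proof -
  obtain m' where m': "m' \<in> AC_moves r G" "\<And>u. u \<in> tuples r G \<Longrightarrow> m' (m u) = u"
    using AC_moves_inverse[OF m] by metis
  have ut: "u \<in> tuples r G" using u by (simp add: NGen_def)
  then have mt: "m u \<in> tuples r G"
    using AC_moves_normal[OF m normal_carrier] by (simp add: tuples_def)
  have "carrier G \<subseteq> N" if N: "N \<lhd> G" "m u ` {1..r} \<subseteq> N" for N
  proof -
    have "m u \<in> {1..r} \<rightarrow>\<^sub>E N" using mt N(2) by (auto simp: tuples_def PiE_iff)
    from AC_moves_normal[OF m'(1) N(1) this] have "u ` {1..r} \<subseteq> N"
      using m'(2)[OF ut] by auto
    then have "normal_closure G (u ` {1..r}) \<subseteq> N"
      using N(1) by (auto simp: normal_closure_def)
    then show ?thesis using u by (simp add: NGen_def)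
  qed
  then have "carrier G \<subseteq> normal_closure G (m u ` {1..r})"
    by (auto simp: normal_closure_def)
  moreover have "normal_closure G (m u ` {1..r}) \<subseteq> carrier G"
    using normal_carrier mt by (auto simp: normal_closure_def tuples_def)
  ultimately show ?thesis using mt by (auto simp: NGen_def)
qed

lemma (in group) AC_moves_Bij:
  assumes m: "m \<in> AC_moves r G"
  shows "restrict m (NGen r G) \<in> carrier (BijGroup (NGen r G))"
proof -
  obtain m' where m': "m' \<in> AC_moves r G" "\<And>u. u \<in> tuples r G \<Longrightarrow> m' (m u) = u"
    "\<And>u. u \<in> tuples r G \<Longrightarrow> m (m' u) = u"
    using AC_moves_inverse[OF m] by metis
  have "bij_betw m (NGen r G) (NGen r G)"
    by (rule bij_betw_byWitness[where f' = m'])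
      (use m m' AC_moves_NGen in \<open>auto simp: NGen_def\<close>)
  then show ?thesis
    by (simp add: BijGroup_def Bij_def)
qed

lemma (in group) group_AC_group: "group (AC_group r G)"
  unfolding AC_group_def by (simp add: group.group_subgroup_generated group_BijGroup)

end

theory Submission
  imports Defs "HOL-Library.Sublist" "HOL-Library.Poly_Mapping" "HOL-Library.Product_Plus"
    "HOL-Computational_Algebra.Polynomial" Complex_Main
begin

text \<open>
  A tuple transformation in \<open>AC(F\<^sub>2)\<close> is given by two words in \<open>x\<^sub>1, x\<^sub>2\<close> (the entries of the tuple)
  and \<open>y\<^sub>1, y\<^sub>2\<close> (the generators of \<open>F\<^sub>2\<close>). These words are unique as elements of the free group of
  rank 4: already the substitutions of conjugates \<open>x\<^sub>1 = y\<^sub>1\<^sup>f\<close>, \<open>x\<^sub>2 = y\<^sub>2\<^sup>g\<close> separate them, as one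
  sees from leading coefficients in \<open>SL\<^sub>2(Z[X])\<close>. Hence abelianising the normal closure of \<open>x\<^sub>1, x\<^sub>2\<close>
  and sending \<open>y\<^sub>1\<close> to \<open>t\<close>, \<open>y\<^sub>2\<close> to \<open>1\<close> is a homomorphism from \<open>AC(F\<^sub>2)\<close> to \<open>GL\<^sub>2(Z[t, 1/t])\<close>.

  The latter group acts on the product of the Bruhat-Tits trees at the places zero and infinity, and
  loops of bounded length cannot wind around a square formed by two edges that are far apart in the
  sense of the action. So in a finite presentation no relator would see such a square, and neither
  would any consequence of the relators. But the relations saying that
  \<open>u\<^sub>1 \<mapsto> u\<^sub>1 (y\<^sub>1\<^sup>n u\<^sub>2 y\<^sub>1\<^sup>-\<^sup>n)\<close> and \<open>u\<^sub>1 \<mapsto> u\<^sub>2 u\<^sub>1\<close> commute wind once around a square that gets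
  arbitrarily far out as \<open>n\<close> grows. The trees enter only through the integers
  \<open>deg (row 1) - deg (row 2)\<close> and \<open>ord (row 1) - ord (row 2)\<close> of a matrix, whose thresholds are the two edges.
\<close>

section \<open>Finitely presentable groups\<close>

lemma foldr_mult_closed:
  assumes "group G" "set l \<subseteq> carrier G"
  shows "foldr (\<otimes>\<^bsub>G\<^esub>) l \<one>\<^bsub>G\<^esub> \<in> carrier G"
proof -
  interpret group G by fact
  show ?thesis using assms(2) by (induction l) auto
qed

lemma hom_foldr_mult:
  assumes "group_hom G H h" "set l \<subseteq> carrier G"
  shows "h (foldr (\<otimes>\<^bsub>G\<^esub>) l \<one>\<^bsub>G\<^esub>) = foldr (\<otimes>\<^bsub>H\<^esub>) (map h l) \<one>\<^bsub>H\<^esub>"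
proof -
  interpret group_hom G H h by fact
  show ?thesis using assms(2)
    by (induction l) (auto simp: foldr_mult_closed[OF G.is_group])
qed

lemma free_group_Cons:
  assumes "a # w \<in> carrier (free_group X)"
  shows "[a] \<in> carrier (free_group X)" "w \<in> carrier (free_group X)"
    "a # w = [a] \<otimes>\<^bsub>free_group X\<^esub> w"
  using assms by (auto simp: free_group_def reduced_Cons push_reduced)

lemma inv_free_group_letter:
  assumes "x \<in> X"
  shows "inv\<^bsub>free_group X\<^esub> [(True, x)] = [(False, x)]"
proof -
  interpret group "free_group X" by (rule group_free_group)
  show ?thesis
    by (rule inv_equality) (use assms in \<open>auto simp: free_group_def inv_letter_def\<close>)
qed

text \<open>Composing the isomorphism with the coset map gives a surjection \<open>\<pi>\<close> of
  the free group itself, along which words can be evaluated directly.\<close>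

lemma finitely_presentable_epi:
  assumes "finitely_presentable G" "group G"
  obtains X :: "nat set" and R \<pi> where "finite X" "finite R" "R \<subseteq> carrier (free_group X)"
    "group_hom (free_group X) G \<pi>" "\<pi> ` carrier (free_group X) = carrier G"
    "kernel (free_group X) G \<pi> = normal_closure (free_group X) R"
proof -
  from assms(1) obtain X :: "nat set" and R where X: "finite X" "finite R"
    and R: "R \<subseteq> carrier (free_group X)"
    and iso: "free_group X Mod normal_closure (free_group X) R \<cong> G"
    unfolding finitely_presentable_def by blast
  let ?F = "free_group X" and ?N = "normal_closure (free_group X) R"
  interpret F: group ?F by (rule group_free_group)
  interpret N: normal ?N ?F by (rule F.normal_closure_normal[OF R])
  interpret G: group G by fact
  obtain \<phi> where \<phi>: "\<phi> \<in> iso (?F Mod ?N) G" using iso by (auto simp: is_iso_def)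
  interpret Q: group "?F Mod ?N" by (rule N.factorgroup_is_group)
  interpret \<phi>: group_hom "?F Mod ?N" G \<phi>
    using \<phi> by (simp add: iso_def group_hom_def group_hom_axioms_def Q.is_group G.is_group)
  define \<pi> where "\<pi> = (\<lambda>w. \<phi> (?N #>\<^bsub>?F\<^esub> w))"
  have cos: "?N #>\<^bsub>?F\<^esub> w \<in> carrier (?F Mod ?N)" if "w \<in> carrier ?F" for w
    using that by (auto simp: FactGroup_def RCOSETS_def)
  have inj: "inj_on \<phi> (carrier (?F Mod ?N))" and img: "\<phi> ` carrier (?F Mod ?N) = carrier G"
    using \<phi> by (auto simp: iso_def bij_betw_def)
  show thesis
  proof (rule that[of X R \<pi>])
    show "group_hom ?F G \<pi>"
    proof (rule group_hom.intro[OF F.is_group G.is_group], unfold group_hom_axioms_def, rule homI)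
      fix u v assume uv: "u \<in> carrier ?F" "v \<in> carrier ?F"
      have "?N #>\<^bsub>?F\<^esub> (u \<otimes>\<^bsub>?F\<^esub> v) = (?N #>\<^bsub>?F\<^esub> u) \<otimes>\<^bsub>?F Mod ?N\<^esub> (?N #>\<^bsub>?F\<^esub> v)"
        using uv N.rcos_sum by simp
      then show "\<pi> (u \<otimes>\<^bsub>?F\<^esub> v) = \<pi> u \<otimes>\<^bsub>G\<^esub> \<pi> v"
        using uv cos by (simp add: \<pi>_def del: mult_FactGroup)
    qed (use cos in \<open>auto simp: \<pi>_def\<close>)
    show "\<pi> ` carrier ?F = carrier G"
    proof -
      have "(\<lambda>w. ?N #>\<^bsub>?F\<^esub> w) ` carrier ?F = carrier (?F Mod ?N)"
        by (auto simp: FactGroup_def RCOSETS_def)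
      then show ?thesis using img by (metis (no_types, lifting) \<pi>_def image_cong image_image)
    qed
    show "kernel ?F G \<pi> = ?N"
    proof (intro Set.set_eqI iffI)
      fix w assume "w \<in> kernel ?F G \<pi>"
      then have w: "w \<in> carrier ?F" and "\<phi> (?N #>\<^bsub>?F\<^esub> w) = \<one>\<^bsub>G\<^esub>"
        by (auto simp: kernel_def \<pi>_def)
      then have "\<phi> (?N #>\<^bsub>?F\<^esub> w) = \<phi> \<one>\<^bsub>?F Mod ?N\<^esub>"
        by (simp del: one_FactGroup)
      then have "?N #>\<^bsub>?F\<^esub> w = \<one>\<^bsub>?F Mod ?N\<^esub>"
        using inj cos[OF w] by (metis Q.one_closed inj_onD)
      then show "w \<in> ?N"
        using w N.subgroup_axioms F.rcos_self by (auto simp: FactGroup_def)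
    next
      fix w assume w: "w \<in> ?N"
      then have "?N #>\<^bsub>?F\<^esub> w = \<one>\<^bsub>?F Mod ?N\<^esub>"
        using F.coset_join2[OF N.mem_carrier N.subgroup_axioms] by (simp add: FactGroup_def)
      then show "w \<in> kernel ?F G \<pi>"
        using w N.mem_carrier by (simp add: kernel_def \<pi>_def del: one_FactGroup)
    qed
  qed (use X R in auto)
qed

text \<open>A map that is multiplicative on the finitely many images of subwords of the relators
  respects every relation of the group.\<close>

lemma finitely_presentable_local_hom:
  fixes G :: "('g, 'm) monoid_scheme"
  assumes fp: "finitely_presentable G" and G: "group G" and P: "finite P" "P \<subseteq> carrier G"
  obtains Q where "finite Q" "Q \<subseteq> carrier G"
    "\<And>(K :: ('k, 'n) monoid_scheme) E l l'. \<lbrakk>group K; E \<in> carrier G \<rightarrow> carrier K;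
       \<And>g h. g \<in> Q \<Longrightarrow> h \<in> Q \<Longrightarrow> E (g \<otimes>\<^bsub>G\<^esub> h) = E g \<otimes>\<^bsub>K\<^esub> E h;
       set l \<subseteq> P; set l' \<subseteq> P;
       foldr (\<otimes>\<^bsub>G\<^esub>) l \<one>\<^bsub>G\<^esub> = foldr (\<otimes>\<^bsub>G\<^esub>) l' \<one>\<^bsub>G\<^esub>\<rbrakk>
     \<Longrightarrow> foldr (\<otimes>\<^bsub>K\<^esub>) (map E l) \<one>\<^bsub>K\<^esub> = foldr (\<otimes>\<^bsub>K\<^esub>) (map E l') \<one>\<^bsub>K\<^esub>"
proof -
  obtain X :: "nat set" and R \<pi> where X: "finite X" "finite R" and R: "R \<subseteq> carrier (free_group X)"
    and \<pi>: "group_hom (free_group X) G \<pi>" and img: "\<pi> ` carrier (free_group X) = carrier G"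
    and ker: "kernel (free_group X) G \<pi> = normal_closure (free_group X) R"
    by (rule finitely_presentable_epi[OF fp G])
  interpret G: group G by fact
  let ?F = "free_group X"
  interpret \<pi>: group_hom ?F G \<pi> by fact
  interpret F: group ?F by (rule group_free_group)
  have "\<exists>w. w \<in> carrier ?F \<and> \<pi> w = p" if "p \<in> carrier G" for p
    using that unfolding img[symmetric] by blast
  then obtain \<sigma> where \<sigma>: "\<And>p. p \<in> carrier G \<Longrightarrow> \<sigma> p \<in> carrier ?F \<and> \<pi> (\<sigma> p) = p"
    by metis
  \<comment> \<open>The chosen preimages of \<open>P\<close> are treated like relators, so that the
    homomorphism built below agrees with \<open>E\<close> on \<open>P\<close> as well.\<close>
  define T where "T = R \<union> \<sigma> ` P"
  have T: "finite T" "T \<subseteq> carrier ?F" using X P R \<sigma> by (auto simp: T_def)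
  \<comment> \<open>Words are taken apart letter by letter from the front, so only images of single
    letters and of suffixes are ever multiplied. Letters of both signs handle inverses, and
    \<open>\<one>\<close> forces \<open>E\<close> to preserve the neutral element.\<close>
  define Q where "Q = \<pi> ` ((\<Union>w\<in>T. set (suffixes w)) \<inter> carrier ?F) \<union> \<pi> ` (\<lambda>a. [a]) ` (UNIV \<times> X) \<union> {\<one>\<^bsub>G\<^esub>}"
  show thesis
  proof (rule that[of Q])
    show "finite Q" using T X by (auto simp: Q_def)
    have single: "[a] \<in> carrier ?F" if "a \<in> UNIV \<times> X" for a
      using that by (auto simp: free_group_def)
    show "Q \<subseteq> carrier G" using single by (auto simp: Q_def)
    fix K :: "('k, 'n) monoid_scheme" and E l l'
    assume K: "group K" and E: "E \<in> carrier G \<rightarrow> carrier K"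
      and mult: "\<And>g h. g \<in> Q \<Longrightarrow> h \<in> Q \<Longrightarrow> E (g \<otimes>\<^bsub>G\<^esub> h) = E g \<otimes>\<^bsub>K\<^esub> E h"
      and l: "set l \<subseteq> P" "set l' \<subseteq> P"
      and eq: "foldr (\<otimes>\<^bsub>G\<^esub>) l \<one>\<^bsub>G\<^esub> = foldr (\<otimes>\<^bsub>G\<^esub>) l' \<one>\<^bsub>G\<^esub>"
    interpret K: group K by fact
    have EK: "E g \<in> carrier K" if "g \<in> carrier G" for g using E that by auto
    have one: "E \<one>\<^bsub>G\<^esub> = \<one>\<^bsub>K\<^esub>"
      using mult[of "\<one>\<^bsub>G\<^esub>" "\<one>\<^bsub>G\<^esub>"] EK[of "\<one>\<^bsub>G\<^esub>"]
      by (simp add: Q_def K.l_cancel_one')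
    let ?f = "\<lambda>x. E (\<pi> [(True, x)])"
    \<comment> \<open>\<open>E\<close> is only a map; \<open>L\<close> is a genuine homomorphism of
      the free group with the same values on the generators. It agrees with \<open>E\<close> after
      \<open>\<pi>\<close> on the words in \<open>T\<close>, hence kills the relators and depends on
      the image under \<open>\<pi>\<close> only.\<close>
    define L where "L = free_lift K ?f"
    have f: "?f x \<in> carrier K" if "x \<in> X" for x using that single EK by auto
    interpret L: group_hom ?F K L
      using free_group_universal(1)[where X = X, OF K f] by (simp add: L_def group_hom_def group_hom_axioms_def group_free_group K)
    have L1: "L [a] = E (\<pi> [a])" if a: "a \<in> UNIV \<times> X" for a
    proof (cases a)
      case (Pair s x)
      then have x: "x \<in> X" using a by auto
      have t: "L [(True, x)] = E (\<pi> [(True, x)])"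
        unfolding L_def by (rule free_group_universal(2)[where X = X, OF K f x]) 
      have "L [(False, x)] = inv\<^bsub>K\<^esub> L [(True, x)]"
        using single x by (metis L.hom_inv SigmaI UNIV_I inv_free_group_letter)
      moreover have "\<pi> [(False, x)] = inv\<^bsub>G\<^esub> \<pi> [(True, x)]"
        using single x by (metis \<pi>.hom_inv SigmaI UNIV_I inv_free_group_letter)
      moreover have "E (inv\<^bsub>G\<^esub> \<pi> [(True, x)]) = inv\<^bsub>K\<^esub> E (\<pi> [(True, x)])"
      proof -
        have "\<pi> [(True, x)] \<in> Q" "\<pi> [(False, x)] \<in> Q" using x by (auto simp: Q_def)
        from mult[OF this(2,1)] have "\<one>\<^bsub>K\<^esub> = E (inv\<^bsub>G\<^esub> \<pi> [(True, x)]) \<otimes>\<^bsub>K\<^esub> E (\<pi> [(True, x)])"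
          using \<open>\<pi> [(False, x)] = _\<close> single x one by simp
        then show ?thesis
          using EK single x by (metis K.inv_equality G.inv_closed SigmaI UNIV_I \<pi>.hom_closed)
      qed
      ultimately show ?thesis using t Pair by (cases s) auto
    qed
    have LE: "L w = E (\<pi> w)" if "w \<in> carrier ?F" "\<forall>v. suffix v w \<longrightarrow> \<pi> v \<in> Q" for w
      using that
    proof (induction w)
      case Nil
      have "\<one>\<^bsub>?F\<^esub> = []" by (simp add: free_group_def)
      then show ?case using L.hom_one \<pi>.hom_one one by metis
    next
      case (Cons a w)
      note aw = free_group_Cons[OF Cons.prems(1)]
      have a: "a \<in> UNIV \<times> X" using Cons.prems(1) by (auto simp: free_group_def)
      have "L w = E (\<pi> w)" using Cons.IH aw(2) Cons.prems(2) by (auto simp: suffix_Cons)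
      moreover have "\<pi> [a] \<in> Q" "\<pi> w \<in> Q" using a Cons.prems(2) by (auto simp: Q_def suffix_Cons)
      ultimately show ?case
        using L.hom_mult[OF aw(1,2)] \<pi>.hom_mult[OF aw(1,2)] mult L1[OF a] aw(3) by metis
    qed
    have LT: "L w = E (\<pi> w)" if w: "w \<in> T" for w
    proof (rule LE)
      show wF: "w \<in> carrier ?F" using w T by auto
      have "v \<in> carrier ?F" if "suffix v w" for v
        using that wF by (auto simp: suffix_def free_group_def reduced_def successively_append_iff)
      then have "v \<in> (\<Union>w\<in>T. set (suffixes w)) \<inter> carrier ?F" if "suffix v w" for v
        using that w by auto
      then show "\<forall>v. suffix v w \<longrightarrow> \<pi> v \<in> Q"
        unfolding Q_def by blast
    qed
    have "R \<subseteq> kernel ?F K L"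
    proof
      fix r assume r: "r \<in> R"
      have "R \<subseteq> normal_closure ?F R" by (auto simp: normal_closure_def)
      then have "\<pi> r = \<one>\<^bsub>G\<^esub>" using ker r by (auto simp: kernel_def)
      then show "r \<in> kernel ?F K L" using LT[of r] r R one by (auto simp: T_def kernel_def)
    qed
    then have kersub: "kernel ?F G \<pi> \<subseteq> kernel ?F K L"
      using L.normal_kernel ker by (auto simp: normal_closure_def)
    have fac: "L w = L w'" if w: "w \<in> carrier ?F" "w' \<in> carrier ?F" "\<pi> w = \<pi> w'" for w w'
    proof -
      have "w \<otimes>\<^bsub>?F\<^esub> inv\<^bsub>?F\<^esub> w' \<in> kernel ?F G \<pi>" using w by (simp add: kernel_def)
      then have "L (w \<otimes>\<^bsub>?F\<^esub> inv\<^bsub>?F\<^esub> w') = \<one>\<^bsub>K\<^esub>" using kersub by (auto simp: kernel_def)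
      then show ?thesis using w by (simp add: K.inv_solve_right' L.hom_inv) 
    qed
    have lift: "\<sigma> ` set l \<subseteq> carrier ?F \<and> map E l = map L (map \<sigma> l) \<and> map \<pi> (map \<sigma> l) = l"
      if "set l \<subseteq> P" for l
      using that P(2) \<sigma> by (auto simp: T_def LT subset_iff map_idI)
    define w where "w = (\<lambda>l. foldr (\<otimes>\<^bsub>?F\<^esub>) (map \<sigma> l) \<one>\<^bsub>?F\<^esub>)"
    have w: "w l \<in> carrier ?F" "\<pi> (w l) = foldr (\<otimes>\<^bsub>G\<^esub>) l \<one>\<^bsub>G\<^esub>"
      "L (w l) = foldr (\<otimes>\<^bsub>K\<^esub>) (map E l) \<one>\<^bsub>K\<^esub>" if "set l \<subseteq> P" for l
      using lift[OF that] unfolding w_def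
      by (simp_all del: map_map map_eq_conv add: foldr_mult_closed group_free_group hom_foldr_mult[OF \<pi>] hom_foldr_mult[OF L.group_hom_axioms])
    show "foldr (\<otimes>\<^bsub>K\<^esub>) (map E l) \<one>\<^bsub>K\<^esub> = foldr (\<otimes>\<^bsub>K\<^esub>) (map E l') \<one>\<^bsub>K\<^esub>"
      using fac[of "w l" "w l'"] w[OF l(1)] w[OF l(2)] eq by simp
  qed
qed

section \<open>Degree norms of Laurent polynomials and of matrices\<close>

type_synonym laurent = "int \<Rightarrow>\<^sub>0 int"

lemma two_powi_le_iff [simp]: "(2::real) powi a \<le> 2 powi b \<longleftrightarrow> a \<le> b"
  by (meson linorder_not_le one_less_numeral_iff power_int_increasing power_int_strict_increasing
      semiring_norm(76) less_imp_le)

text \<open>For \<open>s = 1\<close> this is 2 to the degree, for \<open>s = -1\<close> it is 2 to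
  minus the order: the absolute values at infinity and at zero. The inserted 0 is the norm of the
  zero polynomial.\<close>

definition lnorm :: "int \<Rightarrow> laurent \<Rightarrow> real" where
  "lnorm s f = Max (insert 0 ((\<lambda>k. 2 powi (s * k)) ` Poly_Mapping.keys f))"

lemma lnorm_le_iff: "0 \<le> c \<Longrightarrow> lnorm s f \<le> c \<longleftrightarrow> (\<forall>k\<in>Poly_Mapping.keys f. 2 powi (s * k) \<le> c)"
  by (simp add: lnorm_def)

lemma lnorm_ge: "k \<in> Poly_Mapping.keys f \<Longrightarrow> 2 powi (s * k) \<le> lnorm s f"
  by (simp add: lnorm_def)

lemma lnorm_nonneg [simp]: "0 \<le> lnorm s f"
  by (simp add: lnorm_def)

lemma lnorm_0 [simp]: "lnorm s 0 = 0"
  by (simp add: lnorm_def)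

lemma lnorm_single: "c \<noteq> 0 \<Longrightarrow> lnorm s (Poly_Mapping.single k c) = 2 powi (s * k)"
  by (simp add: lnorm_def max_def)

lemma lnorm_uminus [simp]: "lnorm s (- f) = lnorm s f"
proof -
  have "Poly_Mapping.keys (- f) = Poly_Mapping.keys f" by (auto simp: in_keys_iff)
  then show ?thesis by (simp add: lnorm_def)
qed

lemma lnorm_attained:
  assumes "f \<noteq> 0" obtains k where "k \<in> Poly_Mapping.keys f" "lnorm s f = 2 powi (s * k)"
proof -
  have "lnorm s f \<in> insert 0 ((\<lambda>k. 2 powi (s * k)) ` Poly_Mapping.keys f)"
    unfolding lnorm_def by (rule Max_in) auto
  moreover have "lnorm s f > 0"
  proof -
    obtain k where "k \<in> Poly_Mapping.keys f" using assms by (metis keys_eq_empty all_not_in_conv)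
    then show ?thesis using lnorm_ge[of k f s] by (smt (verit) zero_less_power_int)
  qed
  ultimately show thesis using that by auto
qed

lemma lnorm_pos: "f \<noteq> 0 \<Longrightarrow> 0 < lnorm s f"
  by (metis lnorm_attained zero_less_numeral zero_less_power_int)

lemma lnorm_add: "lnorm s (f + g) \<le> max (lnorm s f) (lnorm s g)"
proof (subst lnorm_le_iff)
  show "\<forall>k\<in>Poly_Mapping.keys (f + g). 2 powi (s * k) \<le> max (lnorm s f) (lnorm s g)"
  proof
    fix k assume "k \<in> Poly_Mapping.keys (f + g)"
    then have "k \<in> Poly_Mapping.keys f \<or> k \<in> Poly_Mapping.keys g" using keys_add[of f g] by blast
    then show "2 powi (s * k) \<le> max (lnorm s f) (lnorm s g)"
      unfolding le_max_iff_disj by (blast intro: lnorm_ge)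
  qed
qed (simp add: le_max_iff_disj)

text \<open>Any pair of exponents of \<open>f\<close> and \<open>g\<close> other than
  \<open>(a, b)\<close> has a strictly smaller value of \<open>s * i + s * j\<close>, so it cannot
  contribute to the coefficient at \<open>a + b\<close>.\<close>

lemma lookup_mult_extremal:
  fixes f g :: laurent
  assumes a: "\<And>k. k \<in> Poly_Mapping.keys f \<Longrightarrow> s * k \<le> s * a" and b: "\<And>k. k \<in> Poly_Mapping.keys g \<Longrightarrow> s * k \<le> s * b"
    and s: "s \<noteq> 0"
  shows "Poly_Mapping.lookup (f * g) (a + b) = Poly_Mapping.lookup f a * Poly_Mapping.lookup g b"
proof -
  define f' where "f' = f - Poly_Mapping.single a (Poly_Mapping.lookup f a)"
  define g' where "g' = g - Poly_Mapping.single b (Poly_Mapping.lookup g b)"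
  have f': "s * k < s * a" if "k \<in> Poly_Mapping.keys f'" for k
  proof -
    from that have "k \<noteq> a" by (auto simp: f'_def in_keys_iff lookup_minus)
    moreover from that this have "k \<in> Poly_Mapping.keys f"
      by (auto simp: f'_def in_keys_iff lookup_minus lookup_single)
    ultimately show ?thesis using a[of k] s by (simp add: order_le_less)
  qed
  have g': "s * k < s * b" if "k \<in> Poly_Mapping.keys g'" for k
  proof -
    from that have "k \<noteq> b" by (auto simp: g'_def in_keys_iff lookup_minus)
    moreover from that this have "k \<in> Poly_Mapping.keys g"
      by (auto simp: g'_def in_keys_iff lookup_minus lookup_single)
    ultimately show ?thesis using b[of k] s by (simp add: order_le_less)
  qed
  have vanish: "Poly_Mapping.lookup (u * v) (a + b) = 0"
    if "\<And>i j. i \<in> Poly_Mapping.keys u \<Longrightarrow> j \<in> Poly_Mapping.keys v \<Longrightarrow> s * i + s * j < s * a + s * b" for u v :: laurent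
  proof (rule ccontr)
    assume "Poly_Mapping.lookup (u * v) (a + b) \<noteq> 0"
    then have "a + b \<in> Poly_Mapping.keys (u * v)" by (simp add: in_keys_iff)
    then obtain i j where "i \<in> Poly_Mapping.keys u" "j \<in> Poly_Mapping.keys v" "a + b = i + j"
      using keys_mult[of u v] by blast
    then show False using that[of i j] by (metis distrib_left less_irrefl)
  qed
  have "f * g = Poly_Mapping.single (a + b) (Poly_Mapping.lookup f a * Poly_Mapping.lookup g b)
      + Poly_Mapping.single a (Poly_Mapping.lookup f a) * g' + f' * Poly_Mapping.single b (Poly_Mapping.lookup g b) + f' * g'"
    by (simp add: f'_def g'_def algebra_simps flip: mult_single)
  moreover have "Poly_Mapping.lookup (Poly_Mapping.single a (Poly_Mapping.lookup f a) * g') (a + b) = 0"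
    "Poly_Mapping.lookup (f' * Poly_Mapping.single b (Poly_Mapping.lookup g b)) (a + b) = 0" "Poly_Mapping.lookup (f' * g') (a + b) = 0"
    by (rule vanish; use f' g' in \<open>fastforce split: if_splits\<close>)+
  ultimately show ?thesis by (simp add: lookup_add)
qed

lemma lnorm_mult:
  assumes s: "s \<noteq> 0" shows "lnorm s (f * g) = lnorm s f * lnorm s g"
proof (cases "f = 0 \<or> g = 0")
  case False
  then obtain a b where a: "a \<in> Poly_Mapping.keys f" "lnorm s f = 2 powi (s * a)"
    and b: "b \<in> Poly_Mapping.keys g" "lnorm s g = 2 powi (s * b)"
    using lnorm_attained by metis
  have ab: "s * k \<le> s * a" if "k \<in> Poly_Mapping.keys f" for k
    using lnorm_ge[OF that, of s] a(2) by simp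
  have bb: "s * k \<le> s * b" if "k \<in> Poly_Mapping.keys g" for k
    using lnorm_ge[OF that, of s] b(2) by simp
  have "Poly_Mapping.lookup (f * g) (a + b) = Poly_Mapping.lookup f a * Poly_Mapping.lookup g b"
    by (rule lookup_mult_extremal[OF ab bb s])
  then have "a + b \<in> Poly_Mapping.keys (f * g)" using a(1) b(1) by (simp add: in_keys_iff)
  from lnorm_ge[OF this, of s] have "lnorm s f * lnorm s g \<le> lnorm s (f * g)"
    by (simp add: a b distrib_left power_int_add)
  moreover have "lnorm s (f * g) \<le> lnorm s f * lnorm s g"
  proof (subst lnorm_le_iff, simp, rule ballI)
    fix k assume "k \<in> Poly_Mapping.keys (f * g)"
    then obtain i j where ij: "i \<in> Poly_Mapping.keys f" "j \<in> Poly_Mapping.keys g" "k = i + j" using keys_mult[of f g] by blast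
    have "(2::real) powi (s * k) = 2 powi (s * i) * 2 powi (s * j)"
      by (simp add: ij distrib_left power_int_add)
    also have "\<dots> \<le> lnorm s f * lnorm s g"
      using ij by (intro mult_mono lnorm_ge) auto
    finally show "2 powi (s * k) \<le> lnorm s f * lnorm s g" .
  qed
  ultimately show ?thesis by simp
qed auto

text \<open>A single exponent contributes reciprocal values to the two norms. The product measures
  the spread between degree and order.\<close>

lemma lnorm_width: "f \<noteq> 0 \<Longrightarrow> 1 \<le> lnorm 1 f * lnorm (-1) f"
proof -
  assume "f \<noteq> 0"
  then obtain k where k: "k \<in> Poly_Mapping.keys f" by (metis keys_eq_empty all_not_in_conv)
  have "(1::real) = 2 powi (1 * k) * 2 powi (-1 * k)" by (simp add: power_int_minus)
  also have "\<dots> \<le> lnorm 1 f * lnorm (-1) f"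
    using k by (intro mult_mono lnorm_ge) auto
  finally show ?thesis .
qed

text \<open>The products for \<open>f\<close> and for \<open>g\<close> are both at least 1 and
  multiply to 1, so a unit has no spread.\<close>

lemma lnorm_unit:
  assumes "f * g = 1" shows "lnorm 1 f * lnorm (-1) f = 1"
proof -
  have nz: "f \<noteq> 0" "g \<noteq> 0" using assms by auto
  have one: "lnorm s 1 = 1" for s using lnorm_single[of 1 s 0] by simp
  have "(lnorm 1 f * lnorm (-1) f) * (lnorm 1 g * lnorm (-1) g) = 1"
    using lnorm_mult[of 1 f g] lnorm_mult[of "-1" f g] one assms by (simp add: ac_simps)
  moreover note lnorm_width[OF nz(1)] lnorm_width[OF nz(2)]
  ultimately show ?thesis
    by (smt (verit) mult_le_cancel_left1)
qed

section \<open>Norms of rows and matrices\<close>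

type_synonym row = "laurent \<times> laurent"
type_synonym mat = "row \<times> row"

definition rnorm :: "int \<Rightarrow> row \<Rightarrow> real" where
  "rnorm s r = max (lnorm s (fst r)) (lnorm s (snd r))"

definition mnorm :: "int \<Rightarrow> mat \<Rightarrow> real" where
  "mnorm s m = max (rnorm s (fst m)) (rnorm s (snd m))"

definition row_mult :: "row \<Rightarrow> mat \<Rightarrow> row" where
  "row_mult r m = (fst r * fst (fst m) + snd r * fst (snd m), fst r * snd (fst m) + snd r * snd (snd m))"

definition mat_mult :: "mat \<Rightarrow> mat \<Rightarrow> mat" where
  "mat_mult m m' = (row_mult (fst m) m', row_mult (snd m) m')"

definition mat_one :: mat where "mat_one = ((1, 0), (0, 1))"

definition mat_det :: "mat \<Rightarrow> laurent" where
  "mat_det m = fst (fst m) * snd (snd m) - snd (fst m) * fst (snd m)"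

lemma row_mult_mat_mult: "row_mult (row_mult r m) m' = row_mult r (mat_mult m m')"
  by (simp add: row_mult_def mat_mult_def algebra_simps)

lemma row_mult_one [simp]: "row_mult r mat_one = r"
  by (simp add: row_mult_def mat_one_def)

lemma mat_det_mult: "mat_det (mat_mult m m') = mat_det m * mat_det m'"
  by (simp add: mat_det_def mat_mult_def row_mult_def algebra_simps)

lemma rnorm_nonneg [simp]: "0 \<le> rnorm s r"
  by (simp add: rnorm_def le_max_iff_disj)

lemma rnorm_Pair_0 [simp]: "rnorm s (a, 0) = lnorm s a" "rnorm s (0, a) = lnorm s a"
  by (simp_all add: rnorm_def max_absorb1 max_absorb2)

lemma rnorm_pos: "r \<noteq> (0, 0) \<Longrightarrow> 0 < rnorm s r"
  by (cases r) (auto simp: rnorm_def less_max_iff_disj lnorm_pos)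

lemma rnorm_row_mult_le:
  assumes s: "s \<noteq> 0" and m: "mnorm s m \<le> C" shows "rnorm s (row_mult r m) \<le> C * rnorm s r"
proof -
  have le: "lnorm s (a * p + b * q) \<le> C * rnorm s (a, b)" if "lnorm s p \<le> C" "lnorm s q \<le> C" for a b p q
  proof -
    have "lnorm s (a * p + b * q) \<le> max (lnorm s a * lnorm s p) (lnorm s b * lnorm s q)"
      using lnorm_add[of s "a * p" "b * q"] by (simp add: lnorm_mult s)
    also have "\<dots> \<le> C * rnorm s (a, b)"
    proof (rule max.boundedI)
      show "lnorm s a * lnorm s p \<le> C * rnorm s (a, b)"
        unfolding mult.commute[of C] by (rule mult_mono) (use that in \<open>auto simp: rnorm_def le_max_iff_disj\<close>)
      show "lnorm s b * lnorm s q \<le> C * rnorm s (a, b)"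
        unfolding mult.commute[of C] by (rule mult_mono) (use that in \<open>auto simp: rnorm_def le_max_iff_disj\<close>)
    qed
    finally show ?thesis .
  qed
  show ?thesis
    using m le[of "fst (fst m)" "fst (snd m)" "fst r" "snd r"] le[of "snd (fst m)" "snd (snd m)" "fst r" "snd r"]
    by (simp add: mnorm_def rnorm_def row_mult_def)
qed

text \<open>If the determinant is small compared with the rows, the rows are nearly proportional, and
  bounded matrices cannot change the ratio of their norms.\<close>

lemma rnorm_ratio_stable:
  assumes s: "s \<noteq> 0" and inv: "mat_mult m m' = mat_one"
    and C: "1 \<le> C" "mnorm s m \<le> C" "mnorm s m' \<le> C"
    and det: "lnorm s (mat_det g) * C ^ 2 < rnorm s (fst g) * rnorm s (snd g)"
  shows "rnorm s (row_mult (fst g) m) * rnorm s (snd g) = rnorm s (fst g) * rnorm s (row_mult (snd g) m)"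
proof -
  let ?N = "lnorm s" and ?R = "rnorm s"
  define sm :: "laurent \<Rightarrow> row \<Rightarrow> row" where "sm c r = (c * fst r, c * snd r)" for c r
  define d where "d = ?N (mat_det g)"
  let ?r1 = "fst g" and ?r2 = "snd g"
  have R_sm: "?R (sm c r) = ?N c * ?R r" for c r
    by (simp add: sm_def rnorm_def lnorm_mult s max_mult_distrib_left)
  have R_add: "?R (a + b) \<le> max (?R a) (?R b)" for a b
    using lnorm_add[of s "fst a" "fst b"] lnorm_add[of s "snd a" "snd b"] by (auto simp: rnorm_def)
  have R_um: "?R (- a) = ?R a" for a by (simp add: rnorm_def)
  have rm: "row_mult (sm c r) n = sm c (row_mult r n)" "row_mult (r + r') n = row_mult r n + row_mult r' n"
    for c r r' n by (simp_all add: row_mult_def sm_def algebra_simps plus_prod_def)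
  \<comment> \<open>Eliminating the coordinate in which the second row attains its norm leaves a
    remainder \<open>v\<close> whose only possible nonzero entry is the determinant up to
    sign.\<close>
  obtain x2 x1 v where x2: "?N x2 = ?R ?r2" and x1: "?N x1 \<le> ?R ?r1" and v: "?R v = d"
    and eq: "sm x2 ?r1 = v + sm x1 ?r2"
  proof (cases "?N (fst ?r2) \<le> ?N (snd ?r2)")
    case True
    show thesis
      by (rule that[of "snd ?r2" "snd ?r1" "(mat_det g, 0)"]; (simp only: rnorm_Pair_0)?)
        (use True in \<open>auto simp: rnorm_def d_def sm_def mat_det_def max_def plus_prod_def algebra_simps\<close>)
  next
    case False
    show thesis
      by (rule that[of "fst ?r2" "fst ?r1" "(0, - mat_det g)"]; (simp only: rnorm_Pair_0 lnorm_uminus)?)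
        (use False in \<open>auto simp: rnorm_def d_def sm_def mat_det_def max_def plus_prod_def algebra_simps\<close>)
  qed
  have d0: "0 \<le> d" by (simp add: d_def)
  have dC: "d \<le> d * C" "d * C \<le> d * C ^ 2"
    using C(1) d0 by (simp_all add: mult_le_cancel_left1 power2_eq_square mult_left_mono)
  have det': "d * C ^ 2 < ?R ?r1 * ?R ?r2" using det by (simp add: d_def)
  then have "0 < ?R ?r1 * ?R ?r2" using d0 by (smt (verit) mult_nonneg_nonneg zero_le_power2)
  then have pos: "0 < ?R ?r1" "0 < ?R ?r2"
    using rnorm_nonneg[of s ?r1] rnorm_nonneg[of s ?r2] by (auto simp: zero_less_mult_iff not_less)
  \<comment> \<open>By the ultrametric inequality \<open>v\<close> is too small to account for the
    left side, so the multiple of the second row must do so. This forces \<open>x1\<close> to attain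
    the norm of the first row.\<close>
  have "?R ?r2 * ?R ?r1 \<le> max d (?N x1 * ?R ?r2)"
    using R_add[of v "sm x1 ?r2"] v x2 eq by (metis R_sm)
  then have "?R ?r1 * ?R ?r2 \<le> ?N x1 * ?R ?r2" using det' dC by (auto simp: mult.commute)
  then have x1: "?N x1 = ?R ?r1" using pos x1 by simp
  let ?s1 = "row_mult ?r1 m" and ?s2 = "row_mult ?r2 m" and ?w = "row_mult v m"
  have eq': "sm x2 ?s1 = ?w + sm x1 ?s2"
    using arg_cong[OF eq, of "\<lambda>r. row_mult r m"] by (simp add: rm)
  have w: "?R ?w \<le> C * d" using rnorm_row_mult_le[OF s C(2), of v] v by simp
  have "?R ?r1 \<le> C * ?R ?s1"
    using rnorm_row_mult_le[OF s C(3), of ?s1] by (simp add: row_mult_mat_mult inv)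
  then have "?R ?r1 * ?R ?r2 \<le> C * ?R ?s1 * ?R ?r2" using pos by simp
  then have "C * (C * d) < C * (?R ?s1 * ?R ?r2)"
    using det' by (simp add: power2_eq_square ac_simps)
  \<comment> \<open>Multiplication by \<open>m\<close> enlarges the remainder at most by
    \<open>C\<close> and shrinks the first row at most by \<open>C\<close>. The remainder is still
    too small to matter, so the two proportional terms have equal norm.\<close>
  then have big: "C * d < ?R ?r2 * ?R ?s1" using C(1) by (simp add: mult.commute)
  have "?R ?r2 * ?R ?s1 \<le> max (?R ?w) (?R ?r1 * ?R ?s2)"
    using R_add[of ?w "sm x1 ?s2"] by (simp add: R_sm x1 x2 flip: eq')
  moreover have "?R ?r1 * ?R ?s2 \<le> max (?R ?r2 * ?R ?s1) (?R ?w)"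
  proof -
    have "sm x1 ?s2 = sm x2 ?s1 + - ?w" using eq' by (simp add: algebra_simps)
    then show ?thesis using R_add[of "sm x2 ?s1" "- ?w"] by (metis R_sm R_um x1 x2)
  qed
  ultimately show ?thesis using big w by (auto simp: mult.commute)
qed

lemma mat_det_unit_row_nonzero:
  assumes "mat_mult m m' = mat_one"
  shows "fst m \<noteq> (0, 0)" "snd m \<noteq> (0, 0)"
proof -
  have "mat_det m * mat_det m' = 1"
    using assms by (simp flip: mat_det_mult) (simp add: mat_det_def mat_one_def)
  then have "mat_det m \<noteq> 0" by auto
  then show "fst m \<noteq> (0, 0)" "snd m \<noteq> (0, 0)" by (auto simp: mat_det_def)
qed

lemma rnorm_width: "r \<noteq> (0, 0) \<Longrightarrow> 1 \<le> rnorm 1 r * rnorm (-1) r"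
proof -
  have le: "lnorm s (fst r) \<le> rnorm s r" "lnorm s (snd r) \<le> rnorm s r" for s
    by (simp_all add: rnorm_def)
  have "x * y \<le> rnorm 1 r * rnorm (-1) r" if "x \<le> rnorm 1 r" "y \<le> rnorm (-1) r" "0 \<le> x" "0 \<le> y" for x y
    using that by (intro mult_mono) auto
  moreover assume "r \<noteq> (0, 0)"
  ultimately show ?thesis
    using lnorm_width[of "fst r"] lnorm_width[of "snd r"] le lnorm_nonneg
    by (cases r) (metis fst_conv snd_conv order_trans)
qed

section \<open>Groups with a representation by invertible matrices\<close>

locale mat_rep = group G for G (structure) +
  fixes M :: "'a \<Rightarrow> mat"
  assumes M_mult: "g \<in> carrier G \<Longrightarrow> h \<in> carrier G \<Longrightarrow> M (g \<otimes> h) = mat_mult (M g) (M h)"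
    and M_one: "M \<one> = mat_one"
begin

definition ratio :: "int \<Rightarrow> 'a \<Rightarrow> real" where
  "ratio s g = rnorm s (fst (M g)) / rnorm s (snd (M g))"

lemma M_inv: "g \<in> carrier G \<Longrightarrow> mat_mult (M g) (M (inv g)) = mat_one"
  by (metis M_mult M_one inv_closed r_inv)

lemma row_pos:
  "g \<in> carrier G \<Longrightarrow> 0 < rnorm s (fst (M g))" "g \<in> carrier G \<Longrightarrow> 0 < rnorm s (snd (M g))"
  using M_inv mat_det_unit_row_nonzero rnorm_pos by blast+

lemma ratio_pos: "g \<in> carrier G \<Longrightarrow> 0 < ratio s g"
  by (simp add: ratio_def row_pos)

definition bounds :: "real \<Rightarrow> 'a \<Rightarrow> bool" where
  "bounds C h \<longleftrightarrow> h \<in> carrier G \<and> 1 \<le> C \<and>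
     (\<forall>s\<in>{1, -1}. mnorm s (M h) \<le> C \<and> mnorm s (M (inv h)) \<le> C)"

lemma exists_bound:
  assumes "finite Q" "Q \<subseteq> carrier G" obtains C where "\<And>h. h \<in> Q \<Longrightarrow> bounds C h"
proof -
  define A where "A = insert 1 ((\<lambda>(s, h). mnorm s (M h)) ` ({1, -1} \<times> (Q \<union> m_inv G ` Q)))"
  have A: "finite A" using assms by (simp add: A_def)
  have "bounds (Max A) h" if "h \<in> Q" for h
    unfolding bounds_def using that assms A
    by (auto intro!: Max_ge simp: A_def)
  then show thesis by (rule that)
qed

lemma row_norm_bound:
  assumes "g \<in> carrier G" "bounds C h" "s \<in> {1, -1}"
  shows "rnorm s (fst (M (g \<otimes> h))) \<le> C * rnorm s (fst (M g))"
    "rnorm s (snd (M (g \<otimes> h))) \<le> C * rnorm s (snd (M g))"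
    "rnorm s (fst (M g)) \<le> C * rnorm s (fst (M (g \<otimes> h)))"
    "rnorm s (snd (M g)) \<le> C * rnorm s (snd (M (g \<otimes> h)))"
proof -
  have s: "s \<noteq> 0" using assms(3) by auto
  have h: "h \<in> carrier G" "mnorm s (M h) \<le> C" "mnorm s (M (inv h)) \<le> C"
    using assms by (auto simp: bounds_def)
  have g: "M g = mat_mult (M (g \<otimes> h)) (M (inv h))"
    using assms(1) h by (metis M_mult inv_closed m_assoc m_closed r_inv r_one)
  show "rnorm s (fst (M (g \<otimes> h))) \<le> C * rnorm s (fst (M g))"
    "rnorm s (snd (M (g \<otimes> h))) \<le> C * rnorm s (snd (M g))"
    using rnorm_row_mult_le[OF s h(2)] by (simp_all add: M_mult assms h mat_mult_def)
  show "rnorm s (fst (M g)) \<le> C * rnorm s (fst (M (g \<otimes> h)))"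
    "rnorm s (snd (M g)) \<le> C * rnorm s (snd (M (g \<otimes> h)))"
    by (simp_all add: g mat_mult_def rnorm_row_mult_le[OF s h(3)])
qed

lemma ratio_bound:
  assumes g: "g \<in> carrier G" and h: "bounds C h" and s: "s \<in> {1, -1}"
  shows "ratio s (g \<otimes> h) \<le> C ^ 2 * ratio s g" "ratio s g \<le> C ^ 2 * ratio s (g \<otimes> h)"
proof -
  have gh: "g \<otimes> h \<in> carrier G" and C: "1 \<le> C" using g h by (auto simp: bounds_def)
  note b = row_norm_bound[OF g h s]
  have *: "a / b \<le> C ^ 2 * (c / d)" if "a \<le> C * c" "d \<le> C * b" "0 < b" "0 < c" "0 < d" "0 < a" for a b c d :: real
  proof -
    have "a * d \<le> (C * c) * (C * b)" using that C by (intro mult_mono) auto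
    then show ?thesis using that by (simp add: field_simps power2_eq_square)
  qed
  show "ratio s (g \<otimes> h) \<le> C ^ 2 * ratio s g" "ratio s g \<le> C ^ 2 * ratio s (g \<otimes> h)"
    unfolding ratio_def by (rule *; use b row_pos g gh in simp)+
qed

text \<open>The contrapositive of \<open>rnorm_ratio_stable\<close>: a bounded element can change
  the ratio only if the rows are small compared with the determinant.\<close>

lemma ratio_change:
  assumes g: "g \<in> carrier G" and h: "bounds C h" and s: "s \<in> {1, -1}" and ne: "ratio s (g \<otimes> h) \<noteq> ratio s g"
  shows "rnorm s (fst (M g)) * rnorm s (snd (M g)) \<le> lnorm s (mat_det (M g)) * C ^ 2"
proof (rule ccontr)
  assume "\<not> ?thesis"
  then have "rnorm s (row_mult (fst (M g)) (M h)) * rnorm s (snd (M g)) =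
      rnorm s (fst (M g)) * rnorm s (row_mult (snd (M g)) (M h))"
    using h s by (intro rnorm_ratio_stable[of s "M h" "M (inv h)" C]) (auto simp: bounds_def M_inv)
  then have "ratio s (g \<otimes> h) = ratio s g"
    using g h row_pos[of "g \<otimes> h" s] row_pos[of g s]
    by (simp add: ratio_def bounds_def M_mult mat_mult_def field_simps)
  with ne show False by simp
qed

text \<open>\<open>ratio 1\<close> and \<open>ratio (-1)\<close> measure the position of \<open>g\<close> in the trees of the places at infinity
  and zero; the thresholds select two edges that are far apart once \<open>n\<close> is large.\<close>

lemma thresholds_not_both_crossed:
  assumes "finite Q" "Q \<subseteq> carrier G"
  obtains n :: nat where "2 \<le> n"
    "\<And>g. g \<in> carrier G \<Longrightarrow>
      (\<forall>h\<in>Q. (2 ^ n \<le> ratio 1 (g \<otimes> h)) = (2 ^ n \<le> ratio 1 g)) \<or>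
      (\<forall>h\<in>Q. (ratio (-1) (g \<otimes> h) \<le> 1/2) = (ratio (-1) g \<le> 1/2))"
proof -
  obtain C where C: "\<And>h. h \<in> Q \<Longrightarrow> bounds C h" using exists_bound[OF assms] by blast
  \<comment> \<open>Of the eight powers of \<open>C\<close>, four come from the two ratios near
    their thresholds and four from the two bounds of \<open>ratio_change\<close>.\<close>
  obtain n0 :: nat where n0: "2 * C ^ 8 < 2 ^ n0" using real_arch_pow[of 2 "2 * C ^ 8"] by auto
  define n where "n = max 2 n0"
  have n: "2 * C ^ 8 < 2 ^ n"
    using n0 power_increasing[of n0 n "2::real"] unfolding n_def by linarith
  show thesis
  proof (rule that[of n])
    show "2 \<le> n" by (simp add: n_def)
    fix g assume g: "g \<in> carrier G"
    show "(\<forall>h\<in>Q. (2 ^ n \<le> ratio 1 (g \<otimes> h)) = (2 ^ n \<le> ratio 1 g)) \<or>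
      (\<forall>h\<in>Q. (ratio (-1) (g \<otimes> h) \<le> 1/2) = (ratio (-1) g \<le> 1/2))"
    proof (rule ccontr)
      assume "\<not> ?thesis"
      then obtain h k where h: "h \<in> Q" "(2 ^ n \<le> ratio 1 (g \<otimes> h)) \<noteq> (2 ^ n \<le> ratio 1 g)"
        and k: "k \<in> Q" "(ratio (-1) (g \<otimes> k) \<le> 1/2) \<noteq> (ratio (-1) g \<le> 1/2)" by blast
      have C1: "1 \<le> C" using C[OF h(1)] by (simp add: bounds_def)
      then have C2: "1 \<le> C ^ 2" by simp
      define a b c d where "a = rnorm 1 (fst (M g))" "b = rnorm 1 (snd (M g))"
        "c = rnorm (-1) (fst (M g))" "d = rnorm (-1) (snd (M g))"
      note abcd = this
      have pos: "0 < a" "0 < b" "0 < c" "0 < d" using row_pos[OF g] by (simp_all add: abcd)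
      have r: "ratio 1 g = a / b" "ratio (-1) g = c / d" by (simp_all add: ratio_def abcd)
      \<comment> \<open>One of \<open>g\<close> and \<open>g \<otimes> h\<close> lies beyond the
        threshold, and their ratios differ at most by the factor \<open>C ^ 2\<close>. The other
        threshold is treated in the same way.\<close>
      have "2 ^ n \<le> C ^ 2 * (a / b)"
        using h(2) ratio_bound(1)[OF g C[OF h(1)], of 1] mult_right_mono[OF C2, of "ratio 1 g"] ratio_pos[OF g, of 1]
        unfolding r by auto
      moreover have "1 / 2 \<le> C ^ 2 * (c / d)"
      proof -
        have "1 / 2 \<le> ratio (-1) (g \<otimes> k) \<or> 1 / 2 \<le> ratio (-1) g" using k(2) by auto
        moreover have "ratio (-1) (g \<otimes> k) \<le> C ^ 2 * (c / d)"
          using ratio_bound(1)[OF g C[OF k(1)], of "-1"] by (simp add: r)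
        moreover have "ratio (-1) g \<le> C ^ 2 * (c / d)"
          using mult_right_mono[OF C2, of "c / d"] pos by (simp add: r)
        ultimately show ?thesis by (meson order_trans)
      qed
      ultimately have "2 ^ n * (1 / 2) \<le> C ^ 2 * (a / b) * (C ^ 2 * (c / d))"
        using C2 pos by (intro mult_mono) auto
      then have 1: "2 ^ n * (b * d) \<le> 2 * C ^ 4 * (a * c)"
        using pos by (simp add: field_simps power2_eq_square power4_eq_xxxx)
      let ?\<delta> = "mat_det (M g)"
      have ab: "a * b \<le> lnorm 1 ?\<delta> * C ^ 2"
        using ratio_change[OF g C[OF h(1)], of 1] h(2) by (auto simp: abcd)
      have cd: "c * d \<le> lnorm (-1) ?\<delta> * C ^ 2"
        using ratio_change[OF g C[OF k(1)], of "-1"] k(2) by (auto simp: abcd)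
      have "(a * b) * (c * d) \<le> (lnorm 1 ?\<delta> * C ^ 2) * (lnorm (-1) ?\<delta> * C ^ 2)"
        by (rule mult_mono[OF ab cd]) (use pos in auto)
      \<comment> \<open>The determinant is a unit, so its contributions at the two places
        cancel.\<close>
      moreover have "lnorm 1 ?\<delta> * lnorm (-1) ?\<delta> = 1"
      proof -
        have "?\<delta> * mat_det (M (inv g)) = 1"
          using M_inv[OF g] by (simp flip: mat_det_mult) (simp add: mat_det_def mat_one_def)
        then show ?thesis by (rule lnorm_unit)
      qed
      ultimately have "(a * c) * (b * d) \<le> C ^ 4"
        by (simp add: ac_simps power2_eq_square power4_eq_xxxx)
      \<comment> \<open>Without this bound on the width of the second row, a small
        \<open>b * d\<close> could compensate a large \<open>a * c\<close>.\<close>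
      moreover have "1 \<le> b * d"
        using rnorm_width mat_det_unit_row_nonzero(2)[OF M_inv[OF g]] by (simp add: abcd)
      ultimately have 2: "a * c \<le> C ^ 4"
        using mult_left_mono[of 1 "b * d" "a * c"] mult_pos_pos[OF pos(1,3)] by linarith
      have "2 ^ n \<le> 2 ^ n * (b * d)" using \<open>1 \<le> b * d\<close> by simp
      also have "\<dots> \<le> 2 * C ^ 4 * (a * c)" by (rule 1)
      also have "\<dots> \<le> 2 * C ^ 4 * C ^ 4" using 2 C1 by (intro mult_left_mono) auto
      also have "\<dots> = 2 * C ^ 8" by (simp flip: power_add)
      finally show False using n by simp
    qed
  qed
qed

end

section \<open>Transvections and ping-pong\<close>

definition bracket :: "'a::comm_ring_1 \<times> 'a \<Rightarrow> 'a \<times> 'a \<Rightarrow> 'a" where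
  "bracket v p = fst v * snd p - snd v * fst p"

definition transv :: "'a::comm_ring_1 \<times> 'a \<Rightarrow> 'a \<Rightarrow> 'a \<times> 'a \<Rightarrow> 'a \<times> 'a" where
  "transv v k p = (fst p + k * bracket v p * fst v, snd p + k * bracket v p * snd v)"

text \<open>The sign depends on parity so that, along the standard basis vectors, positive letters
  of either parity act as elementary matrices with entry 3. With 2 in its place an inverse letter
  would send \<open>(1, 1)\<close> only to the boundary of a ping-pong region.\<close>

definition letter_act :: "(nat \<Rightarrow> 'a::comm_ring_1 \<times> 'a) \<Rightarrow> bool \<times> nat \<Rightarrow> 'a \<times> 'a \<Rightarrow> 'a \<times> 'a" where
  "letter_act V a = transv (V (snd a)) ((if fst a then 1 else -1) * (if odd (snd a) then 3 else -3))"

definition word_act :: "(nat \<Rightarrow> 'a::comm_ring_1 \<times> 'a) \<Rightarrow> nat word \<Rightarrow> 'a \<times> 'a \<Rightarrow> 'a \<times> 'a" where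
  "word_act V w p = foldr (letter_act V) w p"

lemma word_act_Nil [simp]: "word_act V [] p = p"
  and word_act_Cons [simp]: "word_act V (a # w) p = letter_act V a (word_act V w p)"
  and word_act_append: "word_act V (u @ w) p = word_act V u (word_act V w p)"
  by (simp_all add: word_act_def)

lemma transv_transv: "transv v k (transv v l p) = transv v (k + l) p"
  by (simp add: transv_def bracket_def algebra_simps)

lemma transv_0 [simp]: "transv v 0 p = p"
  by (simp add: transv_def)

lemma letter_act_inv [simp]: "letter_act V a (letter_act V (inv_letter a) p) = p"
  by (simp add: letter_act_def inv_letter_def transv_transv)

lemma word_act_push: "word_act V (push a w) p = letter_act V a (word_act V w p)"
  by (cases w) auto

lemma word_act_mult: "word_act V (foldr push u w) p = word_act V u (word_act V w p)"
  by (induction u) (auto simp: word_act_push)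

lemma bracket_transv: "bracket (transv v k p) (transv v k q) = bracket p q"
  by (simp add: transv_def bracket_def algebra_simps)

lemma bracket_word_act: "bracket (word_act V w p) (word_act V w q) = bracket p q"
  by (induction w) (auto simp: letter_act_def bracket_transv)

definition scale :: "'a::comm_ring_1 \<Rightarrow> 'a \<times> 'a \<Rightarrow> 'a \<times> 'a" where
  "scale c p = (c * fst p, c * snd p)"

lemma bracket_scale [simp]: "bracket (scale c p) q = c * bracket p q" "bracket p (scale c q) = c * bracket p q"
  by (simp_all add: bracket_def scale_def algebra_simps)

lemma word_act_linear:
  "word_act V w (a, b) =
     (a * fst (word_act V w (1, 0)) + b * fst (word_act V w (0, 1)),
      a * snd (word_act V w (1, 0)) + b * snd (word_act V w (0, 1)))"
  by (induction w) (auto simp: letter_act_def transv_def bracket_def algebra_simps)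

lemma word_act_scale: "word_act V w (scale c p) = scale c (word_act V w p)"
  by (induction w) (auto simp: letter_act_def transv_def scale_def bracket_def algebra_simps)

text \<open>Words preserve \<open>bracket\<close>, so conjugating a transvection by a word just
  moves its axis.\<close>

lemma word_act_transv: "word_act V w (transv v k p) = transv (word_act V w v) k (word_act V w p)"
  by (induction w) (auto simp: letter_act_def transv_def bracket_def algebra_simps)

section \<open>Ping-pong on integer vectors\<close>

definition basis_vec :: "nat \<Rightarrow> int \<times> int" where
  "basis_vec k = (if odd k then (1, 0) else (0, 1))"

text \<open>The four regions are told apart by which coordinate has the larger absolute value
  (\<open>b\<close>: the first one) and by whether the signs agree (\<open>s\<close>). Both
  coordinates are nonzero.\<close>

definition pp_region :: "bool \<Rightarrow> bool \<Rightarrow> int \<times> int \<Rightarrow> bool" where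
  "pp_region s b p = (case (if b then p else (snd p, fst p)) of (x, y) \<Rightarrow>
     if s then (0 < y \<and> y < x) \<or> (x < y \<and> y < 0) else (0 < y \<and> x < - y) \<or> (y < 0 \<and> - y < x))"

text \<open>Each letter maps \<open>(1, 1)\<close> and every region except that of its inverse into
  its own region. The letters \<open>k\<close> and \<open>Suc k\<close> are distinguished by
  parity.\<close>

lemma ping_pong:
  assumes "reduced w" "w \<noteq> []" "snd ` set w \<subseteq> {k, Suc k}"
  shows "pp_region (fst (hd w)) (odd (snd (hd w))) (word_act basis_vec w (1, 1))"
  using assms
proof (induction w)
  case (Cons a w)
  obtain s g where a: "a = (s, g)" by (cases a)
  show ?case
  proof (cases w)
    case Nil
    then show ?thesis
      by (auto simp: a pp_region_def letter_act_def transv_def bracket_def basis_vec_def)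
  next
    case (Cons b v)
    obtain t h where b: "b = (t, h)" by (cases b)
    obtain x y where xy: "word_act basis_vec w (1, 1) = (x, y)" by fastforce
    have "pp_region t (odd h) (x, y)"
      using Cons.IH Cons.prems Cons xy b by (auto simp: reduced_Cons)
    moreover have "(t, h) \<noteq> (\<not> s, g)"
      using Cons.prems Cons a b by (auto simp: reduced_Cons inv_letter_def)
    moreover have "odd g = odd h \<longleftrightarrow> g = h"
      using Cons.prems a b Cons by auto
    moreover have "letter_act basis_vec (s, g) (x, y) =
        (if odd g then (if s then (x + 3 * y, y) else (x - 3 * y, y))
         else (if s then (x, y + 3 * x) else (x, y - 3 * x)))"
      by (simp add: letter_act_def transv_def bracket_def basis_vec_def)
    ultimately show ?thesis
      unfolding a word_act_Cons xy pp_region_def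
      by (cases s; cases t; cases "odd g"; cases "odd h"; simp; linarith)
  qed
qed simp

text \<open>No region meets the diagonal. The sign \<open>c = -1\<close> serves to exclude words
  that act as minus the identity.\<close>

lemma word_act_basis_ne:
  assumes "reduced w" "w \<noteq> []" "snd ` set w \<subseteq> {k, Suc k}" "\<bar>c\<bar> = 1"
  shows "word_act basis_vec w (1, 1) \<noteq> (c, c)"
  using ping_pong[OF assms(1-3)] assms(4) by (auto simp: pp_region_def split: if_splits)

section \<open>Leading terms of polynomial vectors\<close>

text \<open>\<open>d\<close> is only an upper bound for the degree, since \<open>c\<close> may vanish.\<close>

definition lead :: "int poly \<Rightarrow> nat \<Rightarrow> int \<Rightarrow> bool" where
  "lead f d c \<longleftrightarrow> degree f \<le> d \<and> coeff f d = c"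

definition vlead :: "int poly \<times> int poly \<Rightarrow> nat \<Rightarrow> int \<times> int \<Rightarrow> bool" where
  "vlead p d l \<longleftrightarrow> lead (fst p) d (fst l) \<and> lead (snd p) d (snd l)"

lemma lead_mult: "lead f d a \<Longrightarrow> lead g e b \<Longrightarrow> lead (f * g) (d + e) (a * b)"
proof -
  assume f: "lead f d a" and g: "lead g e b"
  have "coeff (f * g) (d + e) = coeff f d * coeff g e"
  proof (cases "degree f = d \<and> degree g = e")
    case True
    then show ?thesis using coeff_mult_degree_sum by blast
  next
    case False
    then have "degree f < d \<or> degree g < e" using f g by (auto simp: lead_def)
    moreover from this have "degree (f * g) < d + e"
      using f g degree_mult_le[of f g] by (auto simp: lead_def)
    ultimately show ?thesis by (auto simp: coeff_eq_0)
  qed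
  then show ?thesis
    using f g degree_mult_le[of f g] by (auto simp: lead_def)
qed

lemma lead_add: "lead f d a \<Longrightarrow> lead g d b \<Longrightarrow> lead (f + g) d (a + b)"
  by (auto simp: lead_def degree_add_le)

lemma lead_diff: "lead f d a \<Longrightarrow> lead g d b \<Longrightarrow> lead (f - g) d (a - b)"
  by (auto simp: lead_def degree_diff_le)

lemma lead_raise: "lead f d a \<Longrightarrow> d < e \<Longrightarrow> lead f e 0"
  by (auto simp: lead_def coeff_eq_0)

lemma lead_of_int: "lead (of_int k) 0 k"
  by (simp add: lead_def of_int_poly)

text \<open>The added multiple of \<open>v\<close> has degree at most \<open>d + 2\<close> and
  leaves \<open>p\<close> behind, so the leading vector takes the direction \<open>v'\<close>. The
  factor \<open>bracket v' l\<close> decides whether it is nonzero.\<close>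

lemma vlead_transv:
  assumes v: "vlead v 1 v'" and p: "vlead p d l"
  shows "vlead (transv v (of_int k) p) (d + 2) (scale (k * bracket v' l) v')"
proof -
  have b: "lead (bracket v p) (1 + d) (bracket v' l)"
    unfolding bracket_def by (intro lead_diff lead_mult) (use assms in \<open>auto simp: vlead_def\<close>)
  have "lead (f + of_int k * bracket v p * g) (d + 2) (k * bracket v' l * c')" if "lead g 1 c'" "lead f d c" for f g c c'
  proof -
    have "lead (of_int k * bracket v p * g) (0 + (1 + d) + 1) (k * bracket v' l * c')"
      by (intro lead_mult lead_of_int b that)
    moreover have "lead f (0 + (1 + d) + 1) 0" using that(2) by (rule lead_raise) simp
    ultimately show ?thesis using lead_add by fastforce
  qed
  then show ?thesis
    using assms by (auto simp: vlead_def transv_def scale_def)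
qed

text \<open>Vectors fixed by the conjugates of \<open>y\<^sub>1\<close>, \<open>y\<^sub>2\<close> by \<open>y\<^sub>1\<^sup>i y\<^sub>2\<^sup>j\<close>, \<open>y\<^sub>2\<^sup>i y\<^sub>1\<^sup>j\<close> (letters 1 and 2) and by the
  generators themselves (letters 3 and 4), as polynomials in \<open>j\<close>.\<close>

definition fix_vec :: "int \<Rightarrow> 'a \<Rightarrow> nat \<Rightarrow> 'a::comm_ring_1 \<times> 'a" where
  "fix_vec i X k = (if k = 1 then (1 + 9 * of_int i * X, 3 * X)
     else if k = 2 then (3 * X, 1 + 9 * of_int i * X)
     else if odd k then (1, 0) else (0, 1))"

text \<open>The coefficient of \<open>X\<close> in \<open>fix_vec i X k\<close> for the letters 1
  and 2.\<close>

definition dir_vec :: "int \<Rightarrow> nat \<Rightarrow> int \<times> int" where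
  "dir_vec i k = (if k = 1 then (9 * i, 3) else (3, 9 * i))"

lemma vlead_fix_vec: "k \<in> {1, 2} \<Longrightarrow> vlead (fix_vec i [:0, 1:] k) 1 (dir_vec i k)"
  by (auto simp: vlead_def fix_vec_def dir_vec_def lead_def of_int_poly numeral_poly one_pCons)

text \<open>The letters concerned act by constant matrices, hence only transform the leading
  vector.\<close>

lemma vlead_letter_act:
  assumes "snd a \<notin> {1, 2}" "vlead p d l"
  shows "vlead (letter_act (fix_vec i [:0, 1:]) a p) d (letter_act basis_vec a l)"
proof -
  have "lead (c * f) d (k * b)" if "lead f d b" "lead c 0 k" for c f k b
    using lead_mult[OF that(2,1)] by simp
  moreover have "lead 3 0 3" "lead (- 3) 0 (- 3)" 
    using lead_of_int[of 3] lead_of_int[of "-3"] by simp_all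
  ultimately show ?thesis
    using assms by (auto simp: vlead_def letter_act_def transv_def fix_vec_def basis_vec_def bracket_def
      intro!: lead_add lead_diff)
qed

text \<open>These brackets appear as factors when a letter 1 or 2 is applied after another such
  letter, or after the start vector \<open>(1, 1)\<close>, with \<open>c\<close> in between. The
  case \<open>c = []\<close>, \<open>k = l\<close> is left out because the bracket vanishes
  there.\<close>

definition generic :: "int \<Rightarrow> nat word \<Rightarrow> bool" where
  "generic i c \<longleftrightarrow> (\<forall>k\<in>{1, 2}.
     bracket (dir_vec i k) (word_act basis_vec c (1, 1)) \<noteq> 0 \<and>
     (\<forall>l\<in>{1, 2}. c \<noteq> [] \<or> k \<noteq> l \<longrightarrow> bracket (dir_vec i k) (word_act basis_vec c (dir_vec i l)) \<noteq> 0))"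

lemma finite_quadratic_roots:
  fixes a b c :: int
  assumes "(a, b, c) \<noteq> (0, 0, 0)" shows "finite {i. a * i ^ 2 + b * i + c = 0}"
proof -
  have "finite {i. poly [:c, b, a:] i = 0}" using assms by (intro poly_roots_finite) auto
  moreover have "{i. a * i ^ 2 + b * i + c = 0} = {i. poly [:c, b, a:] i = 0}"
    by (simp add: power2_eq_square algebra_simps)
  ultimately show ?thesis by simp
qed

text \<open>Each bracket is a polynomial of degree at most two in \<open>i\<close>. For
  \<open>k = l\<close> all its coefficients vanish only if \<open>c\<close> acts as a scalar, which
  ping-pong excludes. For \<open>k \<noteq> l\<close>, and for the bracket with
  \<open>(1, 1)\<close>, vanishing contradicts determinant 1.\<close>

lemma finite_nongeneric:
  assumes c: "reduced c" "snd ` set c \<subseteq> {3, 4}"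
  shows "finite {i. \<not> generic i c}"
proof -
  obtain p r where pr: "word_act basis_vec c (1, 0) = (p, r)" by fastforce
  obtain q s where qs: "word_act basis_vec c (0, 1) = (q, s)" by fastforce
  have det: "p * s - q * r = 1"
    using bracket_word_act[of basis_vec c "(1, 0)" "(0, 1)"] pr qs by (simp add: bracket_def mult.commute)
  have lin: "word_act basis_vec c (x, y) = (x * p + y * q, x * r + y * s)" for x y
    by (subst word_act_linear) (simp add: pr qs)
  have not_scalar: "\<not> (r = 0 \<and> q = 0 \<and> s = p)" if "c \<noteq> []"
  proof
    assume "r = 0 \<and> q = 0 \<and> s = p"
    moreover from this have "\<bar>p\<bar> = 1" using det zdvd1_eq by (metis abs_1 abs_mult diff_0_right mult_zero_left zmult_eq_1_iff abs_minus_cancel)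
    ultimately show False using word_act_basis_ne[OF c(1) that, of 3 p] c(2) lin[of 1 1] by simp
  qed
  have ns: "(a * r, b * (s - p), a' * q) \<noteq> (0, 0, 0)" if "c \<noteq> []" "a \<noteq> 0" "b \<noteq> 0" "a' \<noteq> 0" for a b a'
    using not_scalar that by auto
  have ns': "(a * q, b * (s - p), a' * r) \<noteq> (0, 0, 0)" if "c \<noteq> []" "a \<noteq> 0" "b \<noteq> 0" "a' \<noteq> 0" for a b a'
    using not_scalar that by auto
  have nz: "\<not> (s = 0 \<and> p = 0 \<and> r = q)"
  proof
    assume "s = 0 \<and> p = 0 \<and> r = q"
    then have "q * q = -1" using det by simp
    then show False using zero_le_square[of q] by linarith
  qed
  have "finite {i. bracket (dir_vec i k) (word_act basis_vec c (dir_vec i l)) = 0}"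
    if kl: "k \<in> {1, 2}" "l \<in> {1, 2}" "c \<noteq> [] \<or> k \<noteq> l" for k l
  proof -
    consider "k = 1" "l = 1" | "k = 2" "l = 2" | "k = 1" "l = 2" | "k = 2" "l = 1" using kl by auto
    then show ?thesis
    proof cases
      case 1
      have "bracket (dir_vec i k) (word_act basis_vec c (dir_vec i l))
          = (81 * r) * i ^ 2 + (27 * (s - p)) * i + (-9) * q" for i
        by (simp add: 1 dir_vec_def lin bracket_def power2_eq_square algebra_simps)
      then show ?thesis using finite_quadratic_roots[OF ns[of 81 27 "-9"]] 1 kl by simp
    next
      case 2
      have "bracket (dir_vec i k) (word_act basis_vec c (dir_vec i l))
          = ((-81) * q) * i ^ 2 + (27 * (s - p)) * i + 9 * r" for i
        by (simp add: 2 dir_vec_def lin bracket_def power2_eq_square algebra_simps)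
      then show ?thesis using finite_quadratic_roots[OF ns'[of "-81" 27 9]] 2 kl by simp
    next
      case 3
      have "bracket (dir_vec i k) (word_act basis_vec c (dir_vec i l))
          = (81 * s) * i ^ 2 + (27 * (r - q)) * i + (-9) * p" for i
        by (simp add: 3 dir_vec_def lin bracket_def power2_eq_square algebra_simps)
      then show ?thesis using finite_quadratic_roots[of "81 * s" "27 * (r - q)" "(-9) * p"] nz by auto
    next
      case 4
      have "bracket (dir_vec i k) (word_act basis_vec c (dir_vec i l))
          = ((-81) * p) * i ^ 2 + (27 * (r - q)) * i + 9 * s" for i
        by (simp add: 4 dir_vec_def lin bracket_def power2_eq_square algebra_simps)
      then show ?thesis using finite_quadratic_roots[of "(-81) * p" "27 * (r - q)" "9 * s"] nz by auto
    qed
  qed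
  moreover have "finite {i. bracket (dir_vec i k) (word_act basis_vec c (1, 1)) = 0}" if k: "k \<in> {1, 2}" for k
  proof -
    have 0: "(p + q, r + s) \<noteq> (0, 0)"
    proof
      assume "(p + q, r + s) = (0, 0)"
      then have "p = - q" "r = - s" by auto
      then show False using det by simp
    qed
    have "bracket (dir_vec i 1) (word_act basis_vec c (1, 1)) = 0 * i ^ 2 + (9 * (r + s)) * i + (-3) * (p + q)"
      "bracket (dir_vec i 2) (word_act basis_vec c (1, 1)) = 0 * i ^ 2 + ((-9) * (p + q)) * i + 3 * (r + s)" for i
      by (simp_all add: dir_vec_def lin bracket_def algebra_simps)
    then show ?thesis
      using k finite_quadratic_roots[of 0 "9 * (r + s)" "(-3) * (p + q)"]
        finite_quadratic_roots[of 0 "(-9) * (p + q)" "3 * (r + s)"] 0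
      by auto
  qed
  ultimately have "finite (\<Union>k\<in>{1, 2}. {i. bracket (dir_vec i k) (word_act basis_vec c (1, 1)) = 0} \<union>
      (\<Union>l\<in>{l \<in> {1, 2}. c \<noteq> [] \<or> k \<noteq> l}. {i. bracket (dir_vec i k) (word_act basis_vec c (dir_vec i l)) = 0}))"
    by (intro finite_UN_I) auto
  then show ?thesis
    by (rule rev_finite_subset) (unfold generic_def, blast)
qed

text \<open>There are finitely many words of bounded length, and each excludes finitely many
  \<open>i\<close>.\<close>

lemma exists_generic:
  obtains i :: nat where "\<And>c. reduced c \<Longrightarrow> snd ` set c \<subseteq> {3, 4} \<Longrightarrow> length c \<le> n \<Longrightarrow> generic (int i) c"
proof -
  let ?W = "{c :: nat word. reduced c \<and> snd ` set c \<subseteq> {3, 4} \<and> length c \<le> n}"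
  have "set c \<subseteq> UNIV \<times> {3, 4}" if "snd ` set c \<subseteq> {3, 4}" for c :: "nat word"
    using that unfolding mem_Times_iff subset_iff by blast
  then have "?W \<subseteq> {c :: nat word. set c \<subseteq> UNIV \<times> {3, 4} \<and> length c \<le> n}"
    by (intro Collect_mono) simp
  moreover have "finite {c :: nat word. set c \<subseteq> UNIV \<times> {3, 4} \<and> length c \<le> n}"
    by (rule finite_lists_length_le) simp
  ultimately have "finite ?W" by (rule finite_subset)
  then have fin: "finite (\<Union>c\<in>?W. {i. \<not> generic i c})"
    by (intro finite_UN_I finite_nongeneric) auto
  moreover have "infinite (range int)" by (simp add: infinite_UNIV_nat finite_image_iff)
  ultimately have "\<not> range int \<subseteq> (\<Union>c\<in>?W. {i. \<not> generic i c})"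
    using finite_subset[OF _ fin] by blast
  then obtain i where "int i \<notin> (\<Union>c\<in>?W. {i. \<not> generic i c})" by blast
  then show thesis using that[of i] by blast
qed

text \<open>The third clause records the maximal power of \<open>x\<^sub>1\<close> or \<open>x\<^sub>2\<close> at the front of the word; without
  it a repeated letter would seem to annihilate the leading term.\<close>

definition has_leading_term :: "int \<Rightarrow> nat word \<Rightarrow> bool" where
  "has_leading_term i W \<longleftrightarrow> (\<exists>c rest d l. W = c @ rest \<and> snd ` set c \<subseteq> {3, 4} \<and> vlead (word_act (fix_vec i [:0, 1:]) W (1, 1)) d l \<and>
    (if rest = [] then d = 0 \<and> l = word_act basis_vec c (1, 1)
     else snd (hd rest) \<in> {1, 2} \<and> 0 < d \<and> (\<exists>m. m \<noteq> 0 \<and> l = word_act basis_vec c (scale m (dir_vec i (snd (hd rest)))))) \<and>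
    (c = [] \<and> rest \<noteq> [] \<longrightarrow> (\<exists>Q n d' l'. n \<noteq> 0 \<and> (fst (hd rest) \<longleftrightarrow> (0 < n) = odd (snd (hd rest))) \<and>
       word_act (fix_vec i [:0, 1:]) W (1, 1) = transv (fix_vec i [:0, 1:] (snd (hd rest))) (of_int n) Q \<and>
       vlead Q d' l' \<and> bracket (dir_vec i (snd (hd rest))) l' \<noteq> 0)))"

text \<open>The word is built up from its right end. Letters 3 and 4 transform the leading vector;
  letters 1 and 2 turn it into a multiple of their own direction, nonzero by genericity.\<close>

lemma leading_term:
  assumes "reduced W" "snd ` set W \<subseteq> {1..4}"
    and gen: "\<And>c. reduced c \<Longrightarrow> snd ` set c \<subseteq> {3, 4} \<Longrightarrow> length c \<le> length W \<Longrightarrow> generic i c"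
  shows "has_leading_term i W"
  using assms
proof (induction W)
  case Nil
  have "vlead (1, 1) 0 (1, 1)" using lead_of_int[of 1] by (simp add: vlead_def)
  then show ?case
    unfolding has_leading_term_def by (intro exI[of _ "[]"] exI[of _ 0] exI[of _ "(1, 1)"]) auto
next
  case (Cons a W)
  let ?V = "fix_vec i [:0, 1:] :: nat \<Rightarrow> int poly \<times> int poly"
  obtain s g where a: "a = (s, g)" by (cases a)
  have red: "reduced W" "snd ` set W \<subseteq> {1..4}" using Cons.prems by (auto simp: reduced_Cons)
  have gen: "generic i c" if "reduced c" "snd ` set c \<subseteq> {3, 4}" "length c \<le> length W" for c
    using Cons.prems(3) that by simp
  have "has_leading_term i W" using Cons.IH[OF red] gen by blast
  then obtain c rest d l where W: "W = c @ rest" and c: "snd ` set c \<subseteq> {3, 4}"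
    and vl: "vlead (word_act ?V W (1, 1)) d l"
    and r: "if rest = [] then d = 0 \<and> l = word_act basis_vec c (1, 1)
     else snd (hd rest) \<in> {1, 2} \<and> 0 < d \<and> (\<exists>m. m \<noteq> 0 \<and> l = word_act basis_vec c (scale m (dir_vec i (snd (hd rest)))))"
    and Q: "c = [] \<and> rest \<noteq> [] \<longrightarrow> (\<exists>Q n d' l'. n \<noteq> 0 \<and> (fst (hd rest) \<longleftrightarrow> (0 < n) = odd (snd (hd rest))) \<and>
       word_act ?V W (1, 1) = transv (?V (snd (hd rest))) (of_int n) Q \<and>
       vlead Q d' l' \<and> bracket (dir_vec i (snd (hd rest))) l' \<noteq> 0)"
    unfolding has_leading_term_def by (elim exE conjE) (rule that)
  show ?case
  proof (cases "g \<in> {1, 2}")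
    case False
    then have g: "g \<in> {3, 4}" using Cons.prems(2) a by auto
    show ?thesis
      unfolding has_leading_term_def
    proof (intro exI conjI)
      show "a # W = (a # c) @ rest" using W by simp
      show "vlead (word_act ?V (a # W) (1, 1)) d (letter_act basis_vec a l)"
        using vlead_letter_act[OF _ vl] False a by simp
      show "if rest = [] then d = 0 \<and> letter_act basis_vec a l = word_act basis_vec (a # c) (1, 1)
        else snd (hd rest) \<in> {1, 2} \<and> 0 < d \<and> (\<exists>m. m \<noteq> 0 \<and> letter_act basis_vec a l
          = word_act basis_vec (a # c) (scale m (dir_vec i (snd (hd rest)))))"
        using r by (auto split: if_splits)
    qed (use c g a in auto)
  next
    case True
    let ?n = "(if s then 1 else -1) * (if odd g then 3 else -3) :: int"
    have act: "word_act ?V (a # W) (1, 1) = transv (?V g) (of_int ?n) (word_act ?V W (1, 1))"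
      by (simp add: a letter_act_def)
    have n: "?n \<noteq> 0" "s \<longleftrightarrow> (0 < ?n) = odd g" by auto
    obtain Q n d' l' where *: "n \<noteq> 0" "s \<longleftrightarrow> (0 < n) = odd g"
       "word_act ?V (a # W) (1, 1) = transv (?V g) (of_int n) Q"
       "vlead Q d' l'" "bracket (dir_vec i g) l' \<noteq> 0"
    \<comment> \<open>A repeated letter is merged with the earlier power, whose vector
      \<open>Q\<close> is kept. As the word is reduced, both exponents have the same sign and cannot
      cancel. In the other case the vector of the whole remaining word serves as
      \<open>Q\<close>.\<close>
    proof (cases "c = [] \<and> rest \<noteq> [] \<and> snd (hd rest) = g")
      case True
      then have "\<exists>Q n d' l'. n \<noteq> 0 \<and> (fst (hd rest) \<longleftrightarrow> (0 < n) = odd g) \<and>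
         word_act ?V W (1, 1) = transv (?V g) (of_int n) Q \<and> vlead Q d' l' \<and> bracket (dir_vec i g) l' \<noteq> 0"
        using Q by simp
      then obtain Q n d' l' where 1: "n \<noteq> 0" "fst (hd rest) \<longleftrightarrow> (0 < n) = odd g"
         "word_act ?V W (1, 1) = transv (?V g) (of_int n) Q"
         "vlead Q d' l'" "bracket (dir_vec i g) l' \<noteq> 0"
        by (elim exE conjE) (rule that)
      have "fst (hd rest) = s"
        using Cons.prems(1) True W a by (cases rest) (auto simp: reduced_Cons inv_letter_def prod_eq_iff)
      then have "(0 < n) = (0 < ?n)" using 1(2) n(2) by auto
      show thesis
      proof (rule that[of "?n + n" Q])
        show "?n + n \<noteq> 0" "s \<longleftrightarrow> (0 < ?n + n) = odd g"
          using \<open>(0 < n) = (0 < ?n)\<close> n 1(1) by (auto split: if_splits)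
        show "word_act ?V (a # W) (1, 1) = transv (?V g) (of_int (?n + n)) Q"
          unfolding act 1(3) transv_transv by (simp only: of_int_add)
      qed (use 1 in auto)
    next
      case False
      have red: "reduced c" using Cons.prems(1) W by (auto simp: reduced_def successively_append_iff successively_Cons)
      have gn: "generic i c" using Cons.prems(3)[OF red c] W by simp
      have "bracket (dir_vec i g) l \<noteq> 0"
      proof (cases "rest = []")
        case True
        then show ?thesis using r gn \<open>g \<in> {1, 2}\<close> by (auto simp: generic_def)
      next
        case ne: False
        then obtain m where "snd (hd rest) \<in> {1, 2}" "m \<noteq> 0"
          "l = word_act basis_vec c (scale m (dir_vec i (snd (hd rest))))" using r by auto
        then show ?thesis using gn \<open>g \<in> {1, 2}\<close> False ne unfolding generic_def word_act_scale bracket_scale by fastforce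
      qed
      then show thesis using that[OF n act vl] by blast
    qed
    have vl': "vlead (word_act ?V (a # W) (1, 1)) (d' + 2) (scale (n * bracket (dir_vec i g) l') (dir_vec i g))"
      unfolding *(3) by (rule vlead_transv[OF vlead_fix_vec[OF True] *(4)])
    show ?thesis
      unfolding has_leading_term_def
    proof (intro exI conjI)
      show "a # W = [] @ (a # W)" by simp
      show "vlead (word_act ?V (a # W) (1, 1)) (d' + 2) (scale (n * bracket (dir_vec i g) l') (dir_vec i g))"
        by (rule vl')
      show "if a # W = [] then d' + 2 = 0 \<and> scale (n * bracket (dir_vec i g) l') (dir_vec i g) = word_act basis_vec [] (1, 1)
        else snd (hd (a # W)) \<in> {1, 2} \<and> 0 < d' + 2 \<and> (\<exists>m. m \<noteq> 0 \<and> scale (n * bracket (dir_vec i g) l') (dir_vec i g)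
          = word_act basis_vec [] (scale m (dir_vec i (snd (hd (a # W))))))"
        using True *(1,5) a by (auto intro!: exI[of _ "n * bracket (dir_vec i g) l'"])
      show "[] = [] \<and> a # W \<noteq> [] \<longrightarrow> (\<exists>Q n d' l'. n \<noteq> 0 \<and>
          (fst (hd (a # W)) \<longleftrightarrow> (0 < n) = odd (snd (hd (a # W)))) \<and>
          word_act ?V (a # W) (1, 1) = transv (?V (snd (hd (a # W)))) (of_int n) Q \<and>
          vlead Q d' l' \<and> bracket (dir_vec i (snd (hd (a # W)))) l' \<noteq> 0)"
        unfolding a list.sel fst_conv snd_conv using *[unfolded a]
        by (intro impI exI[of _ Q] exI[of _ n] exI[of _ d'] exI[of _ l'] conjI)
    qed simp
  qed
qed

lemma poly_transv: 
  "map_prod (\<lambda>f. poly f x) (\<lambda>f. poly f x) (transv v k p) =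
     transv (map_prod (\<lambda>f. poly f x) (\<lambda>f. poly f x) v) (poly k x) (map_prod (\<lambda>f. poly f x) (\<lambda>f. poly f x) p)"
  by (simp add: transv_def bracket_def map_prod_def split_beta)

lemma poly_word_act:
  "map_prod (\<lambda>f. poly f x) (\<lambda>f. poly f x) (word_act (fix_vec i [:0, 1:]) w (1, 1)) = word_act (fix_vec i x) w (1, 1)"
proof (induction w)
  case (Cons a w)
  have "map_prod (\<lambda>f. poly f x) (\<lambda>f. poly f x) (fix_vec i [:0, 1:] k) = fix_vec i x k" for k
    by (simp add: fix_vec_def of_int_poly)
  then show ?case by (simp add: letter_act_def poly_transv Cons)
qed simp

text \<open>If a letter 1 or 2 occurs, there is a nonzero leading vector in positive degree, so the
  polynomial vector is not constant; otherwise ping-pong applies. A polynomial other than 1 takes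
  another value at some natural number, which gives \<open>j\<close>.\<close>

lemma word_act_nontrivial:
  assumes W: "reduced W" "snd ` set W \<subseteq> {1..4}" "W \<noteq> []"
  obtains i j :: nat where "word_act (fix_vec (int i) (int j)) W (1, 1) \<noteq> (1, 1)"
proof -
  obtain i :: nat where i: "\<And>c. reduced c \<Longrightarrow> snd ` set c \<subseteq> {3, 4} \<Longrightarrow> length c \<le> length W \<Longrightarrow> generic (int i) c"
    using exists_generic[of "length W"] by blast
  let ?P = "word_act (fix_vec (int i) [:0, 1:]) W (1, 1) :: int poly \<times> int poly"
  have "?P \<noteq> (1, 1)"
  proof
    assume P: "?P = (1, 1)"
    have "has_leading_term (int i) W" using leading_term[OF W(1,2) i] .
    then obtain c rest d l where cr: "W = c @ rest" "snd ` set c \<subseteq> {3, 4}" "vlead ?P d l"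
      and r: "if rest = [] then d = 0 \<and> l = word_act basis_vec c (1, 1)
        else snd (hd rest) \<in> {1, 2} \<and> 0 < d \<and> (\<exists>m. m \<noteq> 0 \<and> l = word_act basis_vec c (scale m (dir_vec i (snd (hd rest)))))"
      unfolding has_leading_term_def by (elim exE conjE) (rule that; assumption)
    show False
    proof (cases "rest = []")
      case True
      then have "l = (1, 1)" using r cr(3) P by (simp add: prod_eq_iff vlead_def lead_def)
      then show False
        using word_act_basis_ne[of c 3 1] True r cr W by (simp add: numeral_eq_Suc)
    next
      case False
      then obtain m where m: "0 < d" "m \<noteq> 0" "l = word_act basis_vec c (scale m (dir_vec i (snd (hd rest))))"
        using r by auto
      then have "l = (0, 0)" using cr(3) P by (simp add: prod_eq_iff vlead_def lead_def)
      \<comment> \<open>Words preserve \<open>bracket\<close>, so a zero image would give a nonzero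
        multiple of \<open>dir_vec\<close> a zero bracket with every vector.\<close>
      moreover have "bracket (0, 0) q = (0 :: int)" for q by (simp add: bracket_def)
      ultimately have "m * bracket (dir_vec i (snd (hd rest))) z = 0" for z
        using m(3) bracket_word_act[of basis_vec c "scale m (dir_vec i (snd (hd rest)))" z]
        by (metis bracket_scale(1))
      from this[of "(1, 0)"] this[of "(0, 1)"] show False
        using m(2) by (auto simp: dir_vec_def bracket_def split: if_splits)
    qed
  qed
  have "\<exists>j. word_act (fix_vec (int i) (int j)) W (1, 1) \<noteq> (1, 1)"
  proof (rule ccontr)
    assume "\<not> ?thesis"
    then have j: "poly (fst ?P) (int j) = 1 \<and> poly (snd ?P) (int j) = 1" for j
      using poly_word_act[of "int j" "int i" W] by (cases ?P) auto
    have "f = 1" if "\<And>j. poly f (int j) = 1" for f :: "int poly"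
    proof (rule ccontr)
      assume "f \<noteq> 1"
      then have "finite {x. poly (f - 1) x = 0}" by (intro poly_roots_finite) simp
      moreover have "range int \<subseteq> {x. poly (f - 1) x = 0}" using that by auto
      ultimately have "finite (range int)" by (rule rev_finite_subset)
      then show False by (simp add: infinite_UNIV_nat finite_image_iff)
    qed
    then show False using j \<open>?P \<noteq> (1, 1)\<close> by (cases ?P) auto
  qed
  then show thesis using that by blast
qed

abbreviation F2 :: "nat word monoid" where "F2 \<equiv> free_group {1..2}"
text \<open>Letters 1 and 2 are the tuple entries \<open>x\<^sub>1\<close>,
  \<open>x\<^sub>2\<close>; letters 3 and 4 are the generators \<open>y\<^sub>1\<close>,
  \<open>y\<^sub>2\<close> of \<open>F2\<close>.\<close>

abbreviation F4 :: "nat word monoid" where "F4 \<equiv> free_group {1..4}"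

declare One_nat_def [simp del]

lemma (in group) inv_conj_cancel:
  assumes "c \<in> carrier G" "x \<in> carrier G"
  shows "inv c \<otimes> (c \<otimes> x \<otimes> inv c) \<otimes> c = x"
proof -
  have "inv c \<otimes> (c \<otimes> x \<otimes> inv c) \<otimes> c = inv c \<otimes> (c \<otimes> x \<otimes> (inv c \<otimes> c))"
    using assms by (simp add: m_assoc del: l_inv)
  also have "\<dots> = x" using assms by (simp flip: m_assoc)
  finally show ?thesis .
qed

lemma mult_free_group [simp]: "u \<otimes>\<^bsub>free_group X\<^esub> v = foldr push u v"
  and one_free_group [simp]: "\<one>\<^bsub>free_group X\<^esub> = []"
  by (simp_all add: free_group_def)

lemma letter_in_free_group [simp]: "[(s, x)] \<in> carrier (free_group X) \<longleftrightarrow> x \<in> X"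
  by (auto simp: free_group_def)

lemma free_lift_hom:
  assumes "group H" "\<And>x. x \<in> X \<Longrightarrow> f x \<in> carrier H"
  shows "group_hom (free_group X) H (free_lift H f)"
  using free_group_universal(1)[where X = X, OF assms] assms(1)
  by (simp add: group_hom_def group_hom_axioms_def group_free_group)

lemma free_lift_letter:
  assumes "group H" "\<And>x. x \<in> X \<Longrightarrow> f x \<in> carrier H" "x \<in> X"
  shows "free_lift H f [(s, x)] = (if s then f x else inv\<^bsub>H\<^esub> f x)"
proof -
  interpret group H by fact
  show ?thesis using assms(2,3) by (simp add: free_lift_def)
qed

lemma free_group_hom_eq:
  assumes "group_hom (free_group X) H h" "group_hom (free_group X) H h'"
    "\<And>x. x \<in> X \<Longrightarrow> h [(True, x)] = h' [(True, x)]" "w \<in> carrier (free_group X)"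
  shows "h w = h' w"
proof -
  interpret h: group_hom "free_group X" H h by fact
  interpret h': group_hom "free_group X" H h' by fact
  have cl: "h' [(True, x)] \<in> carrier H" if "x \<in> X" for x using that by simp
  show ?thesis
    using free_group_universal(3)[where X = X and f = "\<lambda>x. h' [(True, x)]", OF h.H.group_axioms cl _ _ assms(4)]
      h.homh h'.homh assms(3) by metis
qed

section \<open>Evaluation of words in the generators and in a pair\<close>

definition eval_letter :: "(nat \<Rightarrow> nat word) \<Rightarrow> nat \<Rightarrow> nat word" where
  "eval_letter u k = (if k \<le> 2 then u k else [(True, k - 2)])"

definition eval_at :: "(nat \<Rightarrow> nat word) \<Rightarrow> nat word \<Rightarrow> nat word" where
  "eval_at u = free_lift F2 (eval_letter u)"

lemma eval_letter_closed:
  assumes "u \<in> tuples 2 F2" "k \<in> {1..4}"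
  shows "eval_letter u k \<in> carrier F2"
proof (cases "k \<le> 2")
  case True
  then have "k \<in> {1..2}" using assms(2) by auto
  then show ?thesis using assms(1) True by (auto simp: eval_letter_def tuples_def)
next
  case False
  then have "k - 2 \<in> {1..2}" using assms(2) by auto
  then show ?thesis using False by (simp add: eval_letter_def)
qed

lemma eval_at_hom: "u \<in> tuples 2 F2 \<Longrightarrow> group_hom F4 F2 (eval_at u)"
  unfolding eval_at_def by (intro free_lift_hom group_free_group eval_letter_closed)

lemma eval_at_letter:
  assumes "u \<in> tuples 2 F2" "k \<in> {1..4}"
  shows "eval_at u [(s, k)] = (if s then eval_letter u k else inv\<^bsub>F2\<^esub> eval_letter u k)"
  unfolding eval_at_def
  by (rule free_lift_letter[of F2 "{1..4}"]) (use assms eval_letter_closed in \<open>auto simp: group_free_group\<close>)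

lemma word_act_inv:
  assumes w: "w \<in> carrier (free_group X)"
  shows "word_act V w (word_act V (inv\<^bsub>free_group X\<^esub> w) p) = p"
proof -
  interpret group "free_group X" by (rule group_free_group)
  have "foldr push w (inv\<^bsub>free_group X\<^esub> w) = []" using r_inv[OF w] by simp
  then show ?thesis by (metis word_act_mult word_act_Nil)
qed

text \<open>Both sides are multiplicative in \<open>w\<close>, so comparing letters suffices;
  inverse letters follow by cancellation.\<close>

lemma word_act_free_lift:
  assumes f: "\<And>k. k \<in> X \<Longrightarrow> f k \<in> carrier (free_group Y)"
    "\<And>k p. k \<in> X \<Longrightarrow> word_act U (f k) p = letter_act V (True, k) p"
    and "set w \<subseteq> UNIV \<times> X"
  shows "word_act U (free_lift (free_group Y) f w) p = word_act V w p"
  using assms(3)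
proof (induction w)
  case Nil
  then show ?case by (simp add: free_lift_def)
next
  case (Cons a w)
  obtain s k where a: "a = (s, k)" and k: "k \<in> X" using Cons.prems by auto
  have inv: "word_act U (inv\<^bsub>free_group Y\<^esub> f k) q = letter_act V (False, k) q" for q
  proof -
    let ?r = "word_act U (inv\<^bsub>free_group Y\<^esub> f k) q"
    have "letter_act V (True, k) ?r = q" using word_act_inv[OF f(1)[OF k]] f(2)[OF k] by metis
    moreover have "letter_act V (False, k) (letter_act V (True, k) ?r) = ?r"
      using letter_act_inv[of V "(False, k)"] by (simp add: inv_letter_def)
    ultimately show ?thesis by simp
  qed
  have "free_lift (free_group Y) f (a # w) =
      foldr push (if s then f k else inv\<^bsub>free_group Y\<^esub> f k) (free_lift (free_group Y) f w)"
    by (simp add: free_lift_def a)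
  then show ?case
    using Cons inv f(2)[OF k] a by (simp add: word_act_mult)
qed

text \<open>The test pairs: \<open>y\<^sub>1\<close>, \<open>y\<^sub>2\<close> conjugated by
  \<open>y\<^sub>1\<^sup>i y\<^sub>2\<^sup>j\<close> and
  \<open>y\<^sub>2\<^sup>i y\<^sub>1\<^sup>j\<close>. The index \<open>3 - k\<close> is the other
  generator.\<close>

definition conj_pair :: "nat \<Rightarrow> nat \<Rightarrow> nat \<Rightarrow> nat word" where
  "conj_pair i j = (\<lambda>k\<in>{1..2}.
     let c = replicate i (True, k) @ replicate j (True, 3 - k)
     in c \<otimes>\<^bsub>F2\<^esub> [(True, k)] \<otimes>\<^bsub>F2\<^esub> inv\<^bsub>F2\<^esub> c)"

lemma conjugator_closed:
  assumes "k \<in> {1..2}"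
  shows "replicate i (True, k) @ replicate j (True, 3 - k) \<in> carrier F2"
proof -
  have *: "reduced (replicate n (True, l) @ w)" if "reduced w" "fst (hd w) \<or> w = []" for n l and w :: "nat word"
    using that by (induction n) (auto simp: reduced_Cons inv_letter_def hd_append split: if_splits)
  have "reduced (replicate j (True, 3 - k))" using *[of "[]" j "3 - k"] by simp
  then have "reduced (replicate i (True, k) @ replicate j (True, 3 - k))"
    by (rule *) (auto simp: hd_replicate)
  then show ?thesis using assms by (auto simp: free_group_def)
qed

lemma conj_pair_closed: "conj_pair i j \<in> tuples 2 F2"
proof -
  interpret group F2 by (rule group_free_group)
  show ?thesis
    unfolding tuples_def conj_pair_def Let_def
    by (intro restrict_PiE_iff[THEN iffD2] ballI m_closed inv_closed conjugator_closed) auto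
qed

text \<open>Undoing the conjugations inside a normal subgroup recovers both generators.\<close>

lemma conj_pair_NGen: "conj_pair i j \<in> NGen 2 F2"
proof -
  interpret group F2 by (rule group_free_group)
  have "carrier F2 \<subseteq> N" if N: "N \<lhd> F2" "conj_pair i j ` {1..2} \<subseteq> N" for N
  proof -
    interpret N: normal N F2 by fact
    have gen: "[(True, k)] \<in> N" if k: "k \<in> {1..2}" for k
    proof -
      define c where "c = replicate i (True, k) @ replicate j (True, 3 - k)"
      have c: "c \<in> carrier F2" unfolding c_def by (rule conjugator_closed[OF k])
      have y: "[(True, k)] \<in> carrier F2" using k by simp
      have "c \<otimes>\<^bsub>F2\<^esub> [(True, k)] \<otimes>\<^bsub>F2\<^esub> inv\<^bsub>F2\<^esub> c \<in> N"
        using N(2) k by (auto simp: conj_pair_def c_def Let_def simp del: mult_free_group)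
      then have "inv\<^bsub>F2\<^esub> c \<otimes>\<^bsub>F2\<^esub> (c \<otimes>\<^bsub>F2\<^esub> [(True, k)] \<otimes>\<^bsub>F2\<^esub> inv\<^bsub>F2\<^esub> c) \<otimes>\<^bsub>F2\<^esub> c \<in> N"
        using c N.inv_op_closed1 by blast
      moreover have "inv\<^bsub>F2\<^esub> c \<otimes>\<^bsub>F2\<^esub> (c \<otimes>\<^bsub>F2\<^esub> [(True, k)] \<otimes>\<^bsub>F2\<^esub> inv\<^bsub>F2\<^esub> c) \<otimes>\<^bsub>F2\<^esub> c = [(True, k)]"
        by (rule inv_conj_cancel[OF c y])
      ultimately show ?thesis by simp
    qed
    have gen': "[(s, k)] \<in> N" if k: "k \<in> {1..2}" for s k
      using gen[OF k] N.m_inv_closed[OF gen[OF k]] inv_free_group_letter[OF k] by (cases s) auto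
    show ?thesis
    proof
      fix w assume "w \<in> carrier F2"
      then show "w \<in> N"
      proof (induction w)
        case Nil
        then show ?case using N.one_closed by simp
      next
        case (Cons a w)
        have "[a] \<in> N" using free_group_Cons(1)[OF Cons.prems] gen' by (cases a) auto
        then have "[a] \<otimes>\<^bsub>F2\<^esub> w \<in> N" using Cons free_group_Cons(2)[OF Cons.prems] N.m_closed by blast
        then show ?case using free_group_Cons(3)[OF Cons.prems] by simp
      qed
    qed
  qed
  moreover have "conj_pair i j ` {1..2} \<subseteq> carrier F2"
    using conj_pair_closed[of i j] by (auto simp: tuples_def PiE_iff)
  then have "normal_closure F2 (conj_pair i j ` {1..2}) \<subseteq> carrier F2"
    using normal_carrier by (auto simp: normal_closure_def)
  ultimately show ?thesis
    using conj_pair_closed unfolding NGen_def normal_closure_def by blast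
qed

lemma word_act_replicate_basis:
  "word_act basis_vec (replicate n (True, k)) (x, y) =
     (if odd k then (x + 3 * int n * y, y) else (x, y + 3 * int n * x))"
  by (induction n) (auto simp: letter_act_def transv_def bracket_def basis_vec_def algebra_simps)

text \<open>By \<open>word_act_transv\<close> the conjugates act as transvections along the axes
  moved by \<open>c\<close>, which are the vectors \<open>fix_vec\<close>. Letters 3 and 4 keep
  their parity under the shift by 2.\<close>

lemma word_act_conj_pair:
  assumes "set w \<subseteq> UNIV \<times> {1..4}"
  shows "word_act basis_vec (eval_at (conj_pair i j) w) p = word_act (fix_vec (int i) (int j)) w p"
  unfolding eval_at_def
proof (rule word_act_free_lift[OF _ _ assms])
  fix k q assume k: "k \<in> {1..4::nat}"
  show "eval_letter (conj_pair i j) k \<in> carrier F2"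
    by (rule eval_letter_closed[OF conj_pair_closed k])
  show "word_act basis_vec (eval_letter (conj_pair i j) k) q = letter_act (fix_vec (int i) (int j)) (True, k) q"
  proof (cases "k \<le> 2")
    case True
    then have k12: "k \<in> {1..2}" using k by auto
    define c where "c = replicate i (True, k) @ replicate j (True, 3 - k)"
    have c: "c \<in> carrier F2" unfolding c_def by (rule conjugator_closed[OF k12])
    have "eval_letter (conj_pair i j) k = foldr push (foldr push c [(True, k)]) (inv\<^bsub>F2\<^esub> c)"
      using True k12 by (simp add: eval_letter_def conj_pair_def c_def)
    then have "word_act basis_vec (eval_letter (conj_pair i j) k) q =
        transv (word_act basis_vec c (basis_vec k)) (if odd k then 3 else -3) q"
      using word_act_inv[OF c, of basis_vec q] by (simp add: word_act_mult letter_act_def word_act_transv)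
    moreover have "word_act basis_vec c (basis_vec k) = fix_vec (int i) (int j) k"
    proof -
      have "k = 1 \<or> k = 2" using k12 by auto
      then show ?thesis
        by (auto simp: c_def word_act_append basis_vec_def fix_vec_def word_act_replicate_basis)
    qed
    ultimately show ?thesis by (simp add: letter_act_def)
  next
    case False
    then have "odd (k - 2) \<longleftrightarrow> odd k" "k \<noteq> 1" "k \<noteq> 2" by auto
    then show ?thesis using False
      by (simp add: eval_letter_def letter_act_def basis_vec_def fix_vec_def)
  qed
qed

text \<open>A nonempty word moves \<open>(1, 1)\<close> for some conjugating exponents, so its value
  at that \<open>conj_pair\<close> is not trivial. This is what makes the words of a transformation
  unique.\<close>

lemma eval_at_separates:
  assumes w: "w \<in> carrier F4" and triv: "\<And>u. u \<in> NGen 2 F2 \<Longrightarrow> eval_at u w = []"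
  shows "w = []"
proof (rule ccontr)
  assume ne: "w \<noteq> []"
  have w': "reduced w" "set w \<subseteq> UNIV \<times> {1..4}" "snd ` set w \<subseteq> {1..4}" using w by (auto simp: free_group_def)
  obtain i j :: nat where "word_act (fix_vec (int i) (int j)) w (1, 1) \<noteq> (1, 1)"
    using word_act_nontrivial[OF w'(1,3) ne] by blast
  then show False
    using word_act_conj_pair[OF w'(2), of i j "(1, 1)"] triv[OF conj_pair_NGen[of i j]] by simp
qed

section \<open>The linear representation\<close>

abbreviation tpow :: "int \<Rightarrow> laurent" where "tpow k \<equiv> Poly_Mapping.single k 1"

lemma tpow_add: "tpow (k + l) = tpow k * tpow l"
  by (simp add: mult_single)

text \<open>The semidirect product of the rows of Laurent polynomials with the integers, where
  \<open>k\<close> acts as multiplication by \<open>tpow k\<close>.\<close>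

definition affine_group :: "(row \<times> int) monoid" where
  "affine_group = \<lparr>carrier = UNIV,
     monoid.mult = (\<lambda>(v, k) (w, l). ((fst v + tpow k * fst w, snd v + tpow k * snd w), k + l)),
     one = ((0, 0), 0)\<rparr>"

lemma group_affine_group: "group affine_group"
proof (rule groupI)
  fix x assume "x \<in> carrier affine_group"
  obtain a b k where x: "x = ((a, b), k)" by (metis surj_pair)
  have "((- tpow (- k) * a, - tpow (- k) * b), - k) \<otimes>\<^bsub>affine_group\<^esub> x = \<one>\<^bsub>affine_group\<^esub>"
    by (simp add: affine_group_def x)
  then show "\<exists>y\<in>carrier affine_group. y \<otimes>\<^bsub>affine_group\<^esub> x = \<one>\<^bsub>affine_group\<^esub>"
    by (rule bexI) (simp add: affine_group_def)
qed (auto simp: affine_group_def tpow_add algebra_simps)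

lemma carrier_affine_group [simp]: "x \<in> carrier affine_group"
  by (simp add: affine_group_def)

text \<open>Letters 1 and 2 become the basis rows and letter 3 becomes \<open>t\<close>; letter 4
  falls under every default and becomes neutral.\<close>

definition affine_letter :: "nat \<Rightarrow> row \<times> int" where
  "affine_letter k = ((if k = 1 then 1 else 0, if k = 2 then 1 else 0), if k = 3 then 1 else 0)"

definition affine :: "nat word \<Rightarrow> row \<times> int" where
  "affine = free_lift affine_group affine_letter"

lemma affine_hom: "group_hom F4 affine_group affine"
  unfolding affine_def by (intro free_lift_hom group_affine_group carrier_affine_group)

lemma affine_inv:
  "inv\<^bsub>affine_group\<^esub> ((a, b), k) = ((- tpow (- k) * a, - tpow (- k) * b), - k)"
  by (rule group.inv_equality[OF group_affine_group]) (simp_all add: affine_group_def)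

lemma affine_letter_eq:
  "affine [(s, k)] = (if s then affine_letter k else inv\<^bsub>affine_group\<^esub> affine_letter k)" if "k \<in> {1..4}"
  unfolding affine_def by (rule free_lift_letter[OF group_affine_group _ that]) simp

lemma affine_mult:
  "v \<in> carrier F4 \<Longrightarrow> w \<in> carrier F4 \<Longrightarrow> affine (foldr push v w) =
     ((fst (fst (affine v)) + tpow (snd (affine v)) * fst (fst (affine w)),
       snd (fst (affine v)) + tpow (snd (affine v)) * snd (fst (affine w))),
      snd (affine v) + snd (affine w))"
  using group_hom.hom_mult[OF affine_hom, of v w] by (simp add: affine_group_def split_beta)

text \<open>Requiring the \<open>snd\<close> component to vanish places \<open>affine (W k)\<close>
  in the module of rows, so that it can serve as a row of a matrix and substitution becomes matrix
  multiplication.\<close>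

definition represents :: "((nat \<Rightarrow> nat word) \<Rightarrow> (nat \<Rightarrow> nat word)) \<Rightarrow> (nat \<Rightarrow> nat word) \<Rightarrow> bool" where
  "represents m W \<longleftrightarrow> (\<forall>k\<in>{1..2}. W k \<in> carrier F4 \<and> snd (affine (W k)) = 0 \<and>
     (\<forall>u\<in>NGen 2 F2. m u k = eval_at u (W k)))"

definition words_mat :: "(nat \<Rightarrow> nat word) \<Rightarrow> mat" where
  "words_mat W = (fst (affine (W 1)), fst (affine (W 2)))"

lemma NGen_tuples: "u \<in> NGen 2 F2 \<Longrightarrow> u \<in> tuples 2 F2"
  by (simp add: NGen_def)

lemma represents_unique:
  assumes "represents m W" "represents m W'" "k \<in> {1..2}" shows "W k = W' k"
proof -
  interpret F4: group F4 by (rule group_free_group)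
  interpret F2: group F2 by (rule group_free_group)
  have W: "W k \<in> carrier F4" "W' k \<in> carrier F4" using assms by (auto simp: represents_def)
  have "W k \<otimes>\<^bsub>F4\<^esub> inv\<^bsub>F4\<^esub> W' k = []"
  proof (rule eval_at_separates)
    fix u assume u: "u \<in> NGen 2 F2"
    interpret e: group_hom F4 F2 "eval_at u" by (rule eval_at_hom[OF NGen_tuples[OF u]])
    have "eval_at u (W k) = eval_at u (W' k)" using assms u by (auto simp: represents_def)
    then have "eval_at u (W k \<otimes>\<^bsub>F4\<^esub> inv\<^bsub>F4\<^esub> W' k) = \<one>\<^bsub>F2\<^esub>"
      using W F2.r_inv[OF e.hom_closed[OF W(2)]]
      using e.hom_mult[OF W(1) F4.inv_closed[OF W(2)]] e.hom_inv[OF W(2)] by metis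
    then show "eval_at u (W k \<otimes>\<^bsub>F4\<^esub> inv\<^bsub>F4\<^esub> W' k) = []" by simp
  qed (use W in \<open>simp del: mult_free_group\<close>)
  then have "W k \<otimes>\<^bsub>F4\<^esub> inv\<^bsub>F4\<^esub> W' k = \<one>\<^bsub>F4\<^esub>" by simp
  then show ?thesis using W by (metis F4.inv_closed F4.inv_equality F4.inv_inv)
qed

section \<open>Composition as substitution of words\<close>

definition substitute :: "(nat \<Rightarrow> nat word) \<Rightarrow> nat word \<Rightarrow> nat word" where
  "substitute W = free_lift F4 (\<lambda>k. if k \<le> 2 then W k else [(True, k)])"

lemma substitute_hom:
  assumes "\<And>k. k \<in> {1..2} \<Longrightarrow> W k \<in> carrier F4"
  shows "group_hom F4 F4 (substitute W)"
    "k \<in> {1..4} \<Longrightarrow> substitute W [(True, k)] = (if k \<le> 2 then W k else [(True, k)])"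
proof -
  have *: "(if k \<le> 2 then W k else [(True, k)]) \<in> carrier F4" if "k \<in> {1..4}" for k
    using that assms[of k] by auto
  show "group_hom F4 F4 (substitute W)"
    unfolding substitute_def by (intro free_lift_hom group_free_group *)
  show "k \<in> {1..4} \<Longrightarrow> substitute W [(True, k)] = (if k \<le> 2 then W k else [(True, k)])"
    unfolding substitute_def
    using free_lift_letter[of F4 "{1..4}" "\<lambda>k. if k \<le> 2 then W k else [(True, k)]" k True, OF group_free_group *] by simp
qed

lemma group_hom_comp:
  "group_hom G H f \<Longrightarrow> group_hom H K g \<Longrightarrow> group_hom G K (\<lambda>x. g (f x))"
  by (auto simp: group_hom_def group_hom_axioms_def hom_def Pi_iff)

lemma eval_at_substitute:
  assumes W: "represents m W" and u: "u \<in> NGen 2 F2" "m u \<in> NGen 2 F2" and w: "w \<in> carrier F4"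
  shows "eval_at (m u) w = eval_at u (substitute W w)"
proof (rule free_group_hom_eq[OF eval_at_hom _ _ w])
  have WF: "W k \<in> carrier F4" if "k \<in> {1..2}" for k using W that by (auto simp: represents_def)
  show "m u \<in> tuples 2 F2" by (rule NGen_tuples[OF u(2)])
  show "group_hom F4 F2 (\<lambda>w. eval_at u (substitute W w))"
    by (rule group_hom_comp[OF substitute_hom(1)[OF WF] eval_at_hom[OF NGen_tuples[OF u(1)]]])
  fix k assume k: "k \<in> {1..4::nat}"
  show "eval_at (m u) [(True, k)] = eval_at u (substitute W [(True, k)])"
    using substitute_hom(2)[OF WF k] k W u(1)
    by (auto simp: eval_at_letter NGen_tuples u eval_letter_def represents_def)
qed

text \<open>Both sides are homomorphisms in \<open>w\<close>, so comparing letters suffices. For the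
  right side this rests on multiplication by a matrix commuting with the scalars
  \<open>tpow k\<close>.\<close>

lemma affine_substitute:
  assumes W: "represents m W" and w: "w \<in> carrier F4"
  shows "affine (substitute W w) = (row_mult (fst (affine w)) (words_mat W), snd (affine w))"
proof (rule free_group_hom_eq[OF _ _ _ w])
  have WF: "W k \<in> carrier F4" "snd (affine (W k)) = 0" if "k \<in> {1..2}" for k
    using W that by (auto simp: represents_def)
  show "group_hom F4 affine_group (\<lambda>w. affine (substitute W w))"
    by (rule group_hom_comp[OF substitute_hom(1)[OF WF(1)] affine_hom])
  have "group_hom affine_group affine_group (\<lambda>x. (row_mult (fst x) (words_mat W), snd x))"
    by (auto simp: group_hom_def group_hom_axioms_def group_affine_group intro!: homI)
       (auto simp: affine_group_def row_mult_def algebra_simps)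
  then show "group_hom F4 affine_group (\<lambda>w. (row_mult (fst (affine w)) (words_mat W), snd (affine w)))"
    by (rule group_hom_comp[OF affine_hom])
  fix k assume k: "k \<in> {1..4::nat}"
  have "k = 1 \<or> k = 2 \<or> k = 3 \<or> k = 4" using k by auto
  then show "affine (substitute W [(True, k)]) = (row_mult (fst (affine [(True, k)])) (words_mat W), snd (affine [(True, k)]))"
    using substitute_hom(2)[OF WF(1) k] WF(2)[of 1] WF(2)[of 2]
    by (elim disjE) (simp_all add: affine_letter_eq affine_letter_def row_mult_def words_mat_def prod_eq_iff)
qed

text \<open>The words of the inner map are substituted into those of the outer one. Rows are
  multiplied from the right, so the matrices keep the order of composition.\<close>

lemma represents_comp:
  assumes "represents m W" "represents m' W'" "\<And>u. u \<in> NGen 2 F2 \<Longrightarrow> m' u \<in> NGen 2 F2"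
  shows "represents (\<lambda>u. m (m' u)) (\<lambda>k. substitute W' (W k))"
    "words_mat (\<lambda>k. substitute W' (W k)) = mat_mult (words_mat W) (words_mat W')"
proof -
  have W: "W k \<in> carrier F4" "snd (affine (W k)) = 0" if "k \<in> {1..2}" for k
    using assms(1) that by (auto simp: represents_def)
  have W': "W' k \<in> carrier F4" if "k \<in> {1..2}" for k
    using assms(2) that by (auto simp: represents_def)
  interpret s: group_hom F4 F4 "substitute W'" by (rule substitute_hom(1)[OF W'])
  show "represents (\<lambda>u. m (m' u)) (\<lambda>k. substitute W' (W k))"
    unfolding represents_def
  proof (intro ballI conjI)
    fix k assume k: "k \<in> {1..2::nat}"
    show "substitute W' (W k) \<in> carrier F4" by (rule s.hom_closed[OF W(1)[OF k]])
    show "snd (affine (substitute W' (W k))) = 0"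
      using affine_substitute[OF assms(2) W(1)[OF k]] W(2)[OF k] by simp
    fix u assume u: "u \<in> NGen 2 F2"
    show "m (m' u) k = eval_at u (substitute W' (W k))"
      using eval_at_substitute[OF assms(2) u assms(3)[OF u] W(1)[OF k]] assms(1,3) u k
      by (auto simp: represents_def)
  qed
  show "words_mat (\<lambda>k. substitute W' (W k)) = mat_mult (words_mat W) (words_mat W')"
    using affine_substitute[OF assms(2) W(1)] by (simp add: words_mat_def mat_mult_def)
qed

lemma represents_cong:
  "represents m W \<Longrightarrow> (\<And>u. u \<in> NGen 2 F2 \<Longrightarrow> m' u = m u) \<Longrightarrow> represents m' W"
  by (simp add: represents_def)

section \<open>Words for the elementary moves\<close>

lemma represents_update:
  assumes "i \<in> {1..2}" "v \<in> carrier F4" "snd (affine v) = 0"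
    "\<And>u. u \<in> NGen 2 F2 \<Longrightarrow> m u = u(i := eval_at u v)"
  shows "represents m (\<lambda>k. if k = i then v else [(True, k)])"
  unfolding represents_def
proof (intro ballI conjI)
  fix k assume k: "k \<in> {1..2::nat}"
  then show "(if k = i then v else [(True, k)]) \<in> carrier F4" using assms(2) by auto
  show "snd (affine (if k = i then v else [(True, k)])) = 0"
    using k assms(3) by (auto simp: affine_letter_eq affine_letter_def)
  fix u assume u: "u \<in> NGen 2 F2"
  show "m u k = eval_at u (if k = i then v else [(True, k)])"
    using k assms(4)[OF u] by (auto simp: eval_at_letter NGen_tuples[OF u] eval_letter_def)
qed

text \<open>The copy of \<open>F2\<close> on the letters 3 and 4.\<close>

definition embed :: "nat word \<Rightarrow> nat word" where
  "embed = free_lift F4 (\<lambda>k. [(True, k + 2)])"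

lemma embed_hom: "group_hom F2 F4 embed"
  unfolding embed_def by (intro free_lift_hom group_free_group) auto

lemma embed_letter: "k \<in> {1..2} \<Longrightarrow> embed [(s, k)] = [(s, k + 2)]"
  unfolding embed_def
  using free_lift_letter[of F4 "{1..2}" "\<lambda>k. [(True, k + 2)]" k s] inv_free_group_letter[of "k + 2" "{1..4}"]
  by (auto simp: group_free_group)

lemma eval_at_embed:
  assumes u: "u \<in> tuples 2 F2" and w: "w \<in> carrier F2"
  shows "eval_at u (embed w) = w"
proof (rule free_group_hom_eq[OF _ _ _ w])
  show "group_hom F2 F2 (\<lambda>w. eval_at u (embed w))"
    by (rule group_hom_comp[OF embed_hom eval_at_hom[OF u]])
  show "group_hom F2 F2 (\<lambda>w. w)"
    by (simp add: group_hom_def group_hom_axioms_def group_free_group hom_def)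
  show "eval_at u (embed [(True, k)]) = [(True, k)]" if "k \<in> {1..2}" for k
    using that by (simp add: embed_letter eval_at_letter u eval_letter_def)
qed

text \<open>As \<open>e\<close> is 1 or -1, the letter \<open>(e = 1, j)\<close> is
  \<open>x\<^sub>j\<close> with exponent \<open>e\<close>.\<close>

lemma represents_R:
  assumes "i \<in> {1..2}" "j \<in> {1..2}" "i \<noteq> j" "e \<in> {1, -1}"
  shows "represents (move_R F2 i j e) (\<lambda>k. if k = i then foldr push [(True, i)] [(e = 1, j)] else [(True, k)])"
proof (rule represents_update[OF assms(1)])
  have ij: "i \<in> {1..4}" "j \<in> {1..4}" using assms by auto
  interpret F4: group F4 by (rule group_free_group)
  interpret F2: group F2 by (rule group_free_group)
  have c: "[(True, i)] \<in> carrier F4" "[(e = 1, j)] \<in> carrier F4" using ij by simp_all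
  show "foldr push [(True, i)] [(e = 1, j)] \<in> carrier F4"
    using F4.m_closed[OF c] by simp
  show "snd (affine (foldr push [(True, i)] [(e = 1, j)])) = 0"
    unfolding affine_mult[OF c] using assms ij by (auto simp: affine_letter_eq affine_letter_def affine_inv)
  fix u assume "u \<in> NGen 2 F2"
  then have u: "u \<in> tuples 2 F2" by (rule NGen_tuples)
  have uj: "u j \<in> carrier F2" using u assms(2) by (auto simp: tuples_def)
  have "eval_at u (foldr push [(True, i)] [(e = 1, j)]) = eval_at u [(True, i)] \<otimes>\<^bsub>F2\<^esub> eval_at u [(e = 1, j)]"
    using group_hom.hom_mult[OF eval_at_hom[OF u] c] by simp
  also have "\<dots> = u i \<otimes>\<^bsub>F2\<^esub> u j [^]\<^bsub>F2\<^esub> e"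
    using assms uj ij by (auto simp: eval_at_letter u eval_letter_def F2.int_pow_neg F2.int_pow_1 simp del: mult_free_group)
  finally show "move_R F2 i j e u = u(i := eval_at u (foldr push [(True, i)] [(e = 1, j)]))"
    by (simp add: move_R_def)
qed

lemma represents_L:
  assumes "i \<in> {1..2}" "j \<in> {1..2}" "i \<noteq> j" "e \<in> {1, -1}"
  shows "represents (move_L F2 i j e) (\<lambda>k. if k = i then foldr push [(e = 1, j)] [(True, i)] else [(True, k)])"
proof (rule represents_update[OF assms(1)])
  have ij: "i \<in> {1..4}" "j \<in> {1..4}" using assms by auto
  interpret F4: group F4 by (rule group_free_group)
  interpret F2: group F2 by (rule group_free_group)
  have c: "[(e = 1, j)] \<in> carrier F4" "[(True, i)] \<in> carrier F4" using ij by simp_all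
  show "foldr push [(e = 1, j)] [(True, i)] \<in> carrier F4"
    using F4.m_closed[OF c] by simp
  show "snd (affine (foldr push [(e = 1, j)] [(True, i)])) = 0"
    unfolding affine_mult[OF c] using assms ij by (auto simp: affine_letter_eq affine_letter_def affine_inv)
  fix u assume "u \<in> NGen 2 F2"
  then have u: "u \<in> tuples 2 F2" by (rule NGen_tuples)
  have uj: "u j \<in> carrier F2" using u assms(2) by (auto simp: tuples_def)
  have "eval_at u (foldr push [(e = 1, j)] [(True, i)]) = eval_at u [(e = 1, j)] \<otimes>\<^bsub>F2\<^esub> eval_at u [(True, i)]"
    using group_hom.hom_mult[OF eval_at_hom[OF u] c] by simp
  also have "\<dots> = u j [^]\<^bsub>F2\<^esub> e \<otimes>\<^bsub>F2\<^esub> u i"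
    using assms uj ij by (auto simp: eval_at_letter u eval_letter_def F2.int_pow_neg F2.int_pow_1 simp del: mult_free_group)
  finally show "move_L F2 i j e u = u(i := eval_at u (foldr push [(e = 1, j)] [(True, i)]))"
    by (simp add: move_L_def)
qed

lemma represents_I:
  assumes "i \<in> {1..2}"
  shows "represents (move_I F2 i) (\<lambda>k. if k = i then [(False, i)] else [(True, k)])"
  by (rule represents_update[OF assms])
    (use assms in \<open>auto simp: affine_letter_eq affine_letter_def affine_inv move_I_def eval_at_letter NGen_tuples eval_letter_def\<close>)

lemma represents_C:
  assumes "i \<in> {1..2}" "w \<in> carrier F2"
  shows "represents (move_C F2 i w) (\<lambda>k. if k = i then foldr push (foldr push (embed w) [(True, i)]) (inv\<^bsub>F4\<^esub> (embed w)) else [(True, k)])"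
proof (rule represents_update[OF assms(1)])
  have i: "i \<in> {1..4}" using assms by auto
  interpret F4: group F4 by (rule group_free_group)
  interpret F2: group F2 by (rule group_free_group)
  interpret embed: group_hom F2 F4 embed by (rule embed_hom)
  interpret affine: group_hom F4 affine_group affine by (rule affine_hom)
  let ?w = "embed w"
  have c: "?w \<in> carrier F4" "[(True, i)] \<in> carrier F4" "inv\<^bsub>F4\<^esub> ?w \<in> carrier F4" using i assms by simp_all
  have c': "foldr push ?w [(True, i)] \<in> carrier F4" using F4.m_closed[OF c(1,2)] by simp
  show "foldr push (foldr push ?w [(True, i)]) (inv\<^bsub>F4\<^esub> ?w) \<in> carrier F4"
    using F4.m_closed[OF c' c(3)] by simp
  \<comment> \<open>The integer parts of \<open>?w\<close> and its inverse cancel, so the conjugate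
    has integer part 0 even where \<open>?w\<close> has not.\<close>
  have "foldr push ?w (inv\<^bsub>F4\<^esub> ?w) = []" using F4.r_inv[OF c(1)] by simp
  then have "snd (affine ?w) + snd (affine (inv\<^bsub>F4\<^esub> ?w)) = snd (affine [])"
    using affine_mult[OF c(1,3)] by (metis snd_conv)
  also have "\<dots> = 0" using affine.hom_one by (simp add: affine_group_def)
  finally show "snd (affine (foldr push (foldr push ?w [(True, i)]) (inv\<^bsub>F4\<^esub> ?w))) = 0"
    unfolding affine_mult[OF c' c(3)] affine_mult[OF c(1,2)] using assms i
    by (simp add: affine_letter_eq affine_letter_def)
  fix u assume "u \<in> NGen 2 F2"
  then have u: "u \<in> tuples 2 F2" by (rule NGen_tuples)
  interpret e: group_hom F4 F2 "eval_at u" by (rule eval_at_hom[OF u])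
  have "eval_at u (?w \<otimes>\<^bsub>F4\<^esub> [(True, i)] \<otimes>\<^bsub>F4\<^esub> inv\<^bsub>F4\<^esub> ?w) = w \<otimes>\<^bsub>F2\<^esub> u i \<otimes>\<^bsub>F2\<^esub> inv\<^bsub>F2\<^esub> w"
    using c assms u i by (simp add: e.hom_mult eval_at_embed eval_at_letter eval_letter_def del: mult_free_group)
  then show "move_C F2 i w u = u(i := eval_at u (foldr push (foldr push ?w [(True, i)]) (inv\<^bsub>F4\<^esub> ?w)))"
    by (simp add: move_C_def)
qed

lemma represents_move:
  assumes "m \<in> AC_moves 2 F2" shows "\<exists>W. represents m W"
proof -
  consider (R) i j e where "m = move_R F2 i j e" "i \<in> {1..2}" "j \<in> {1..2}" "i \<noteq> j" "e \<in> {1, -1}"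
    | (L) i j e where "m = move_L F2 i j e" "i \<in> {1..2}" "j \<in> {1..2}" "i \<noteq> j" "e \<in> {1, -1}"
    | (I) i where "m = move_I F2 i" "i \<in> {1..2}"
    | (C) i w where "m = move_C F2 i w" "i \<in> {1..2}" "w \<in> carrier F2"
    using assms unfolding AC_moves_def by blast
  then show ?thesis
  proof cases
    case R
    show ?thesis unfolding R(1) by (rule exI, rule represents_R[OF R(2-5)])
  next
    case L
    show ?thesis unfolding L(1) by (rule exI, rule represents_L[OF L(2-5)])
  next
    case I
    show ?thesis unfolding I(1) by (rule exI, rule represents_I[OF I(2)])
  next
    case C
    show ?thesis unfolding C(1) by (rule exI, rule represents_C[OF C(2,3)])
  qed
qed

section \<open>Representations that obstruct finite presentability\<close>

context mat_rep
begin

definition near_zero :: "'a \<Rightarrow> bool" where "near_zero g \<longleftrightarrow> ratio (-1) g \<le> 1/2"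

definition near_infinity :: "nat \<Rightarrow> 'a \<Rightarrow> bool" where "near_infinity n g \<longleftrightarrow> 2 ^ n \<le> ratio 1 g"

text \<open>A signed crossing of the threshold at infinity, counted only on the
  \<open>near_zero\<close> side of the other threshold. Summed along a closed path, it measures the
  winding around the square.\<close>

definition jump :: "nat \<Rightarrow> 'a \<Rightarrow> 'a \<Rightarrow> int" where
  "jump n g h = (if near_zero g then of_bool (near_infinity n (g \<otimes> h)) - of_bool (near_infinity n g) else 0)"

text \<open>Because of the inverse, the first components compose in the same order as the group
  elements; whether the counters do is the question of \<open>step_mult\<close>.\<close>

definition step :: "nat \<Rightarrow> 'a \<Rightarrow> 'a \<times> int \<Rightarrow> 'a \<times> int" where
  "step n h x = (fst x \<otimes> inv h, snd x + jump n (fst x) (inv h))"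

abbreviation states :: "('a \<times> int) set" where "states \<equiv> carrier G \<times> UNIV"

definition step_bij :: "nat \<Rightarrow> 'a \<Rightarrow> 'a \<times> int \<Rightarrow> 'a \<times> int" where
  "step_bij n h = restrict (step n h) states"

lemma step_Bij:
  assumes h: "h \<in> carrier G" shows "step_bij n h \<in> carrier (BijGroup states)"
proof -
  have "bij_betw (step n h) states states"
    by (rule bij_betw_byWitness[where f' = "\<lambda>x. (fst x \<otimes> h, snd x - jump n (fst x \<otimes> h) (inv h))"])
       (use h in \<open>auto simp: step_def m_assoc\<close>)
  then show ?thesis by (simp add: step_bij_def BijGroup_def Bij_def)
qed

text \<open>On a fixed finite set the steps compose like the group elements, because no element of the
  group has both of the distant thresholds in its neighbourhood.\<close>

lemma step_mult:
  assumes Q: "finite Q" "Q \<subseteq> carrier G"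
  obtains n where "2 \<le> n" "\<And>h h'. h \<in> Q \<Longrightarrow> h' \<in> Q \<Longrightarrow>
    step_bij n (h \<otimes> h') = step_bij n h \<otimes>\<^bsub>BijGroup states\<^esub> step_bij n h'"
proof -
  let ?S = "m_inv G ` Q \<union> (\<lambda>(h, h'). inv (h \<otimes> h')) ` (Q \<times> Q)"
  have "finite ?S" "?S \<subseteq> carrier G" using Q by auto
  then obtain n where n: "2 \<le> n" and far: "\<And>g. g \<in> carrier G \<Longrightarrow>
      (\<forall>h\<in>?S. near_infinity n (g \<otimes> h) = near_infinity n g) \<or> (\<forall>h\<in>?S. near_zero (g \<otimes> h) = near_zero g)"
    unfolding near_zero_def near_infinity_def by (rule thresholds_not_both_crossed) blast
  show thesis
  proof (rule that[OF n])
    fix h h' assume hh: "h \<in> Q" "h' \<in> Q"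
    then have h: "h \<in> carrier G" "h' \<in> carrier G" using Q by auto
    have "step n (h \<otimes> h') x = step n h (step n h' x)" if xs: "x \<in> states" for x
    proof -
      obtain g k where x: "x = (g, k)" and g: "g \<in> carrier G" using xs by (cases x) auto
      have inv: "inv (h \<otimes> h') = inv h' \<otimes> inv h" using h by (simp add: inv_mult_group)
      have "inv h' \<in> ?S" "inv (h \<otimes> h') \<in> ?S" using hh by auto
      then have "(near_infinity n (g \<otimes> inv h') = near_infinity n g \<and>
          near_infinity n (g \<otimes> inv (h \<otimes> h')) = near_infinity n g) \<or> near_zero (g \<otimes> inv h') = near_zero g"
        using far[OF g] by blast
      \<comment> \<open>If \<open>near_infinity\<close> does not change, all three jumps vanish; if
        \<open>near_zero\<close> does not change, the two jumps on the right telescope.\<close>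
      then have "jump n g (inv (h \<otimes> h')) = jump n g (inv h') + jump n (g \<otimes> inv h') (inv h)"
        using g h by (auto simp: jump_def inv m_assoc)
      then show ?thesis using g h by (simp add: step_def x inv m_assoc)
    qed
    moreover have "step n h' x \<in> states" if "x \<in> states" for x
      using that h by (auto simp: step_def)
    ultimately show "step_bij n (h \<otimes> h') =
        step_bij n h \<otimes>\<^bsub>BijGroup states\<^esub> step_bij n h'"
      using step_Bij[OF h(1)] step_Bij[OF h(2)]
      by (auto simp: BijGroup_def compose_def fun_eq_iff step_bij_def restrict_def)
  qed
qed

lemma foldr_step:
  assumes "set l \<subseteq> carrier G" "x \<in> states"
  shows "foldr (\<otimes>\<^bsub>BijGroup states\<^esub>) (map (step_bij n) l) \<one>\<^bsub>BijGroup states\<^esub> x = foldr (step n) l x"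
proof -
  interpret B: group "BijGroup states" by (rule group_BijGroup)
  let ?E = "step_bij n"
  have "foldr (\<otimes>\<^bsub>BijGroup states\<^esub>) (map ?E l) \<one>\<^bsub>BijGroup states\<^esub> \<in> carrier (BijGroup states) \<and> foldr (step n) l x \<in> states \<and>
    foldr (\<otimes>\<^bsub>BijGroup states\<^esub>) (map ?E l) \<one>\<^bsub>BijGroup states\<^esub> x = foldr (step n) l x"
    using assms(1)
  proof (induction l)
    case Nil
    have "\<one>\<^bsub>BijGroup states\<^esub> x = x" using assms(2) by (simp add: BijGroup_def)
    then show ?case using assms(2) by simp
  next
    case (Cons h l)
    let ?p = "foldr (\<otimes>\<^bsub>BijGroup states\<^esub>) (map ?E l) \<one>\<^bsub>BijGroup states\<^esub>"
    have h: "h \<in> carrier G" "set l \<subseteq> carrier G" using Cons.prems by simp_all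
    have IH: "?p \<in> carrier (BijGroup states)" "foldr (step n) l x \<in> states" "?p x = foldr (step n) l x"
      using Cons.IH[OF h(2)] by blast+
    have "(?E h \<otimes>\<^bsub>BijGroup states\<^esub> ?p) x = ?E h (?p x)"
      using step_Bij[OF h(1), of n] IH(1) assms(2) by (simp add: BijGroup_def compose_def)
    moreover have "?E h (?p x) = step n h (foldr (step n) l x)" using IH(2,3) by (simp add: step_bij_def)
    moreover have "step n h (foldr (step n) l x) \<in> states" using IH(2) h by (auto simp: step_def)
    ultimately show ?case using B.m_closed[OF step_Bij[OF h(1), of n] IH(1)] IH by simp
  qed
  then show ?thesis by blast
qed

section \<open>Paths through affine matrices\<close>

lemma M_inv_eq:
  assumes "g \<in> carrier G" "mat_mult m (M g) = mat_one" shows "M (inv g) = m"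
proof -
  have "M (inv g) = mat_mult (mat_mult m (M g)) (M (inv g))"
    by (simp add: assms(2)) (simp add: mat_mult_def mat_one_def row_mult_def)
  also have "\<dots> = mat_mult m (mat_mult (M g) (M (inv g)))"
    by (simp add: mat_mult_def row_mult_mat_mult[unfolded mat_mult_def])
  also have "\<dots> = m" by (simp add: M_inv assms(1)) (simp add: mat_mult_def)
  finally show ?thesis .
qed

definition affine_mat :: "int \<Rightarrow> laurent \<Rightarrow> mat" where
  "affine_mat i x = ((tpow i, x), (0, 1))"

lemma lnorm_tpow: "lnorm s (tpow i) = 2 powi (s * i)"
  by (rule lnorm_single) simp

lemma lnorm_1: "lnorm s 1 = 1"
  using lnorm_tpow[of s 0] by simp

lemma ratio_affine: "M g = affine_mat i x \<Longrightarrow> ratio s g = max (2 powi (s * i)) (lnorm s x)"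
  by (simp add: ratio_def rnorm_def affine_mat_def lnorm_tpow lnorm_1)

lemma ratio_affine_0: "M g = affine_mat i 0 \<Longrightarrow> ratio s g = 2 powi (s * i)"
  by (simp add: ratio_affine max_absorb1)

lemma two_powi_ge: "2 ^ n \<le> (2 :: real) powi i \<longleftrightarrow> int n \<le> i"
  using two_powi_le_iff[of "int n" i] by (simp add: power_int_of_nat)

lemma two_powi_le_half: "(2 :: real) powi i \<le> 1 / 2 \<longleftrightarrow> i \<le> -1"
  using two_powi_le_iff[of i "-1"] by (simp add: power_int_minus)

text \<open>In the first case the path is off the \<open>near_zero\<close> side, in the second it
  stays on the \<open>near_infinity\<close> side. Diagonal steps then leave the counter
  alone.\<close>

definition static :: "nat \<Rightarrow> laurent \<Rightarrow> bool" where
  "static n x \<longleftrightarrow> 1 / 2 < lnorm (-1) x \<or> 2 ^ n \<le> lnorm 1 x"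

lemma jump_static:
  assumes "M g = affine_mat i x" "M (g \<otimes> h) = affine_mat j y"
    "1 / 2 < lnorm (-1) x \<or> 2 ^ n \<le> lnorm 1 x \<and> 2 ^ n \<le> lnorm 1 y"
  shows "jump n g h = 0"
  using assms(3) by (auto simp: jump_def near_zero_def near_infinity_def ratio_affine[OF assms(1)] ratio_affine[OF assms(2)] le_max_iff_disj)

lemma step_diagonal:
  assumes d: "d \<in> carrier G" "M (inv d) = affine_mat e 0" and g: "g \<in> carrier G" "M g = affine_mat i x" and x: "static n x"
  obtains g' where "g' \<in> carrier G" "M g' = affine_mat (i + int r * e) x" "foldr (step n) (replicate r d) (g, k) = (g', k)"
proof -
  have "\<exists>g'. g' \<in> carrier G \<and> M g' = affine_mat (i + int r * e) x \<and> foldr (step n) (replicate r d) (g, k) = (g', k)"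
  proof (induction r)
    case 0
    then show ?case using g by simp
  next
    case (Suc r)
    then obtain g' where g': "g' \<in> carrier G" "M g' = affine_mat (i + int r * e) x"
      "foldr (step n) (replicate r d) (g, k) = (g', k)" by blast
    have M': "M (g' \<otimes> inv d) = affine_mat (i + int (Suc r) * e) x"
      using g'(1) d by (simp add: M_mult g'(2) affine_mat_def mat_mult_def row_mult_def mult_single algebra_simps)
    have "jump n g' (inv d) = 0"
      by (rule jump_static[OF g'(2) M']) (use x in \<open>auto simp: static_def\<close>)
    then have "step n d (g', k) = (g' \<otimes> inv d, k)" by (simp add: step_def)
    then show ?case using g' d M' by (intro exI[of _ "g' \<otimes> inv d"]) simp
  qed
  then show thesis using that by blast
qed

text \<open>Along the powers of \<open>t\<close> the path becomes \<open>near_zero\<close> at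
  \<open>r = 1\<close> and crosses the threshold at infinity at \<open>r = n\<close>. Since
  \<open>2 \<le> n\<close>, it is \<open>near_zero\<close> just before that crossing, which is
  therefore counted.\<close>

lemma step_diagonal_one:
  assumes d: "d \<in> carrier G" "M (inv d) = affine_mat 1 0" and n: "2 \<le> n"
  obtains g' where "g' \<in> carrier G" "M g' = affine_mat (int r) 0" "foldr (step n) (replicate r d) (\<one>, 0) = (g', of_bool (n \<le> r))"
proof -
  have "\<exists>g'. g' \<in> carrier G \<and> M g' = affine_mat (int r) 0 \<and> foldr (step n) (replicate r d) (\<one>, 0) = (g', of_bool (n \<le> r))"
  proof (induction r)
    case 0
    then show ?case using n by (simp add: M_one mat_one_def affine_mat_def)
  next
    case (Suc r)
    then obtain g' where g': "g' \<in> carrier G" "M g' = affine_mat (int r) 0"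
      "foldr (step n) (replicate r d) (\<one>, 0) = (g', of_bool (n \<le> r))" by blast
    have M': "M (g' \<otimes> inv d) = affine_mat (int (Suc r)) 0"
      using g'(1) d by (simp add: M_mult g'(2) affine_mat_def mat_mult_def row_mult_def mult_single algebra_simps)
    have "near_zero g' \<longleftrightarrow> 1 \<le> r"
      unfolding near_zero_def ratio_affine_0[OF g'(2)] two_powi_le_half by linarith
    moreover have "near_infinity n g' \<longleftrightarrow> n \<le> r"
      unfolding near_infinity_def ratio_affine_0[OF g'(2)] two_powi_ge by simp
    moreover have "near_infinity n (g' \<otimes> inv d) \<longleftrightarrow> n \<le> Suc r"
      by (simp only: near_infinity_def ratio_affine_0[OF M'] two_powi_ge mult_1 of_nat_le_iff)
    ultimately have "of_bool (n \<le> r) + jump n g' (inv d) = of_bool (n \<le> Suc r)"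
      using n by (auto simp: jump_def)
    then have "step n d (g', of_bool (n \<le> r)) = (g' \<otimes> inv d, of_bool (n \<le> Suc r))"
      by (simp add: step_def)
    then show ?case using g' d M' by (intro exI[of _ "g' \<otimes> inv d"]) simp
  qed
  then show thesis using that by blast
qed

lemma step_unipotent:
  assumes a: "a \<in> carrier G" "M (inv a) = affine_mat 0 (-1)" and g: "g \<in> carrier G" "M g = affine_mat i x"
    and x: "1 / 2 < lnorm (-1) x \<or> 2 ^ n \<le> lnorm 1 x \<and> 2 ^ n \<le> lnorm 1 (x - tpow i)"
  obtains g' where "g' \<in> carrier G" "M g' = affine_mat i (x - tpow i)" "step n a (g, k) = (g', k)"
proof (rule that)
  show M': "M (g \<otimes> inv a) = affine_mat i (x - tpow i)"
    using g(1) a by (simp add: M_mult g(2) affine_mat_def mat_mult_def row_mult_def)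
  show "step n a (g, k) = (g \<otimes> inv a, k)"
    using jump_static[OF g(2) M' x] by (simp add: step_def)
qed (use a g in simp)

lemma foldr_replicate_mult:
  "x \<in> carrier G \<Longrightarrow> y \<in> carrier G \<Longrightarrow> foldr (\<otimes>) (replicate n x) y = x [^] n \<otimes> y"
proof (induction n)
  case (Suc n)
  then have "foldr (\<otimes>) (replicate (Suc n) x) y = x \<otimes> x [^] n \<otimes> y" by (simp add: m_assoc)
  then show ?case using Suc.prems by (simp only: nat_pow_Suc2)
qed simp

text \<open>The two sides of the commutation relation are read as paths from \<open>\<one>\<close>
  to the same element. They pass the square on different sides, so their counters end at 0 and at 1,
  whereas a finite presentation would force equal counters for a suitable \<open>n\<close>.\<close>

theorem not_finitely_presentable:
  assumes a: "a \<in> carrier G" "M a = affine_mat 0 1" and b: "b \<in> carrier G" "M b = affine_mat 0 1"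
    and d: "d \<in> carrier G" "M d = affine_mat 1 0"
    and comm: "\<And>n :: nat. d [^] n \<otimes> a \<otimes> inv d [^] n \<otimes> b = b \<otimes> (d [^] n \<otimes> a \<otimes> inv d [^] n)"
  shows "\<not> finitely_presentable G"
proof
  assume "finitely_presentable G"
  define P where "P = {a, b, d, inv d}"
  have P: "finite P" "P \<subseteq> carrier G" using a b d by (auto simp: P_def)
  show False
  proof (rule finitely_presentable_local_hom[OF \<open>finitely_presentable G\<close> is_group P])
    fix Q assume Q: "finite Q" "Q \<subseteq> carrier G"
      and rel: "\<And>(K :: ('a \<times> int \<Rightarrow> 'a \<times> int) monoid) E l l'. \<lbrakk>group K; E \<in> carrier G \<rightarrow> carrier K;
         \<And>g h. g \<in> Q \<Longrightarrow> h \<in> Q \<Longrightarrow> E (g \<otimes> h) = E g \<otimes>\<^bsub>K\<^esub> E h;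
         set l \<subseteq> P; set l' \<subseteq> P; foldr (\<otimes>) l \<one> = foldr (\<otimes>) l' \<one>\<rbrakk>
       \<Longrightarrow> foldr (\<otimes>\<^bsub>K\<^esub>) (map E l) \<one>\<^bsub>K\<^esub> = foldr (\<otimes>\<^bsub>K\<^esub>) (map E l') \<one>\<^bsub>K\<^esub>"
    obtain n where n: "2 \<le> n" and mult: "\<And>h h'. h \<in> Q \<Longrightarrow> h' \<in> Q \<Longrightarrow>
      step_bij n (h \<otimes> h') =
        step_bij n h \<otimes>\<^bsub>BijGroup states\<^esub> step_bij n h'"
      using step_mult[OF Q] by blast
    \<comment> \<open>The right end of a list acts first, and stepping by \<open>inv d\<close>
      multiplies by \<open>d\<close>.\<close>
    define l where "l = replicate n d @ [a] @ replicate n (inv d) @ [b]"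
    define l' where "l' = [b] @ replicate n d @ [a] @ replicate n (inv d)"
    have l: "set l \<subseteq> P" "set l' \<subseteq> P" by (auto simp: l_def l'_def P_def)
    have "foldr (\<otimes>) l \<one> = foldr (\<otimes>) l' \<one>"
      using comm[of n] a b d by (simp add: l_def l'_def foldr_replicate_mult m_assoc del: foldr_replicate)
    then have "foldr (\<otimes>\<^bsub>BijGroup states\<^esub>) (map (step_bij n) l) \<one>\<^bsub>BijGroup states\<^esub>
         = foldr (\<otimes>\<^bsub>BijGroup states\<^esub>) (map (step_bij n) l') \<one>\<^bsub>BijGroup states\<^esub>"
      by (intro rel group_BijGroup l mult) (auto intro: step_Bij)
    then have "foldr (step n) l (\<one>, 0) = foldr (step n) l' (\<one>, 0)"
      using foldr_step[of l "(\<one>, 0)" n] foldr_step[of l' "(\<one>, 0)" n] order_trans[OF l(1) P(2)] order_trans[OF l(2) P(2)]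
      by (simp del: foldr_map)
    moreover have ia: "M (inv a) = affine_mat 0 (-1)" and ib: "M (inv b) = affine_mat 0 (-1)"
      and id: "M (inv d) = affine_mat (-1) 0"
      by (rule M_inv_eq; use a b d in \<open>simp add: affine_mat_def mat_mult_def row_mult_def mat_one_def mult_single\<close>)+
    moreover have iid: "M (inv (inv d)) = affine_mat 1 0" using d by simp
    moreover have "snd (foldr (step n) l (\<one>, 0)) = 0"
    proof -
      \<comment> \<open>After the step by \<open>b\<close> the upper right entry keeps the constant
        coefficient -1, so this path is never \<open>near_zero\<close> and counts nothing.\<close>
      have k0: "0 \<in> Poly_Mapping.keys (- 1 - tpow (int n))" "0 \<in> Poly_Mapping.keys (- 1 :: laurent)"
        using n by (simp_all add: in_keys_iff lookup_minus lookup_single lookup_one)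
      have low: "1 / 2 < lnorm (-1) (-1)" "1 / 2 < lnorm (-1) (- 1 - tpow (int n))"
        using lnorm_ge[OF k0(1), of "-1"] by (simp_all add: lnorm_1)
      have M1: "M \<one> = affine_mat 0 0" by (simp add: M_one mat_one_def affine_mat_def)
      have Mb: "M (\<one> \<otimes> inv b) = affine_mat 0 (-1)" using ib b by simp
      have "\<not> near_zero \<one>" by (simp add: near_zero_def ratio_affine[OF M1])
      then have b1: "step n b (\<one>, 0) = (inv b, 0)" using b by (simp add: step_def jump_def)
      obtain g1 where g1: "g1 \<in> carrier G" "M g1 = affine_mat (0 + int n * 1) (-1)"
        "foldr (step n) (replicate n (inv d)) (inv b, 0) = (g1, 0)"
        by (rule step_diagonal[of "inv d" 1 "inv b" 0 "-1" n n 0]) (use d iid ib b low in \<open>auto simp: static_def\<close>)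
      obtain g2 where g2: "g2 \<in> carrier G" "M g2 = affine_mat (0 + int n * 1) (-1 - tpow (0 + int n * 1))" "step n a (g1, 0) = (g2, 0)"
        by (rule step_unipotent[OF a(1) ia g1(1,2), of n 0]) (use low in auto)
      obtain g3 where "foldr (step n) (replicate n d) (g2, 0) = (g3, 0)"
        by (rule step_diagonal[OF d(1) id g2(1,2), of n n 0]) (use low in \<open>auto simp: static_def\<close>)
      then show ?thesis by (simp add: l_def b1 g1(3) g2(3) del: foldr_replicate)
    qed
    moreover have "snd (foldr (step n) l' (\<one>, 0)) = 1"
    proof -
      \<comment> \<open>On this side the crossing is counted on the way out along the diagonal.
        Afterwards the term of degree \<open>n\<close> in the upper right entry keeps the path on
        the \<open>near_infinity\<close> side.\<close>
      have high: "2 ^ n \<le> lnorm 1 (- tpow (int n))" "2 ^ n \<le> lnorm 1 (- tpow (int n) - 1)"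
      proof -
        have "int n \<in> Poly_Mapping.keys (- tpow (int n) - 1)"
          using n by (simp add: in_keys_iff lookup_minus lookup_single lookup_one)
        from lnorm_ge[OF this, of 1] show "2 ^ n \<le> lnorm 1 (- tpow (int n) - 1)" by (simp add: power_int_of_nat)
        show "2 ^ n \<le> lnorm 1 (- tpow (int n))" by (simp add: lnorm_tpow power_int_of_nat)
      qed
      obtain g1 where g1: "g1 \<in> carrier G" "M g1 = affine_mat (int n) 0"
        "foldr (step n) (replicate n (inv d)) (\<one>, 0) = (g1, 1)"
        by (rule step_diagonal_one[of "inv d" n n]) (use d iid n in auto)
      have M2: "M (g1 \<otimes> inv a) = affine_mat (int n) (- tpow (int n))"
        using g1(1) a(1) by (simp add: M_mult g1(2) ia affine_mat_def mat_mult_def row_mult_def)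
      have "near_infinity n g1" "near_infinity n (g1 \<otimes> inv a)"
        using high by (simp_all add: near_infinity_def ratio_affine[OF g1(2)] ratio_affine[OF M2] le_max_iff_disj two_powi_ge)
      then have a1: "step n a (g1, 1) = (g1 \<otimes> inv a, 1)" by (simp add: step_def jump_def)
      obtain g3 where g3: "g3 \<in> carrier G" "M g3 = affine_mat (int n + int n * -1) (- tpow (int n))"
        "foldr (step n) (replicate n d) (g1 \<otimes> inv a, 1) = (g3, 1)"
        by (rule step_diagonal[OF d(1) id _ M2, of n n 1]) (use g1 a high in \<open>auto simp: static_def\<close>)
      obtain g4 where "step n b (g3, 1) = (g4, 1)"
        by (rule step_unipotent[OF b(1) ib g3(1,2), of n 1]) (use high in auto)
      then show ?thesis by (simp add: l'_def g1(3) a1 g3(3) del: foldr_replicate)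
    qed
    ultimately show False by simp
  qed
qed

end

section \<open>The Andrews-Curtis group\<close>

text \<open>Moves have explicit words, the inverse of a move is again a move, and products are
  handled by substitution.\<close>

lemma AC_group_represented:
  assumes "m \<in> carrier (AC_group 2 F2)"
  shows "m \<in> Bij (NGen 2 F2)" "\<exists>W. represents m W"
proof -
  interpret F2: group F2 by (rule group_free_group)
  interpret B: group "BijGroup (NGen 2 F2)" by (rule group_BijGroup)
  let ?N = "NGen 2 F2" and ?B = "BijGroup (NGen 2 F2)"
  have moves: "represents (restrict m ?N) W" if "represents m W" for m W
    using that by (rule represents_cong) simp
  have "m \<in> generate ?B (carrier ?B \<inter> (\<lambda>m. restrict m ?N) ` AC_moves 2 F2)"
    using assms by (simp add: AC_group_def carrier_subgroup_generated)
  then have "m \<in> carrier ?B \<and> (\<exists>W. represents m W)"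
  proof (induction rule: generate.induct)
    case one
    have "represents (\<lambda>u. u) (\<lambda>k. [(True, k)])"
      by (auto simp: represents_def affine_letter_eq affine_letter_def eval_at_letter NGen_tuples eval_letter_def)
    then have "represents \<one>\<^bsub>?B\<^esub> (\<lambda>k. [(True, k)])"
      by (rule represents_cong) (simp add: BijGroup_def)
    then show ?case by blast
  next
    case (incl h)
    then obtain m where m: "m \<in> AC_moves 2 F2" "h = restrict m ?N" by blast
    obtain W where "represents m W" using represents_move[OF m(1)] by blast
    then have "represents h W" unfolding m(2) by (rule moves)
    then show ?case using incl by blast
  next
    case (inv h)
    then obtain m where m: "m \<in> AC_moves 2 F2" "h = restrict m ?N" by blast
    obtain m' where m': "m' \<in> AC_moves 2 F2" "\<And>u. u \<in> tuples 2 F2 \<Longrightarrow> m' (m u) = u"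
      using F2.AC_moves_inverse[OF m(1)] by metis
    have "restrict m' ?N \<otimes>\<^bsub>?B\<^esub> h = \<one>\<^bsub>?B\<^esub>"
      using F2.AC_moves_Bij[OF m'(1)] F2.AC_moves_Bij[OF m(1)] F2.AC_moves_NGen[OF m(1)] m'(2)
      by (auto simp: m(2) BijGroup_def compose_def NGen_tuples restrict_def fun_eq_iff)
    then have *: "inv\<^bsub>?B\<^esub> h = restrict m' ?N"
      using F2.AC_moves_Bij[OF m'(1)] F2.AC_moves_Bij[OF m(1)] m(2) by (intro B.inv_equality) auto
    obtain W where "represents m' W" using represents_move[OF m'(1)] by blast
    then have "represents (restrict m' ?N) W" by (rule moves)
    then show ?case unfolding * using F2.AC_moves_Bij[OF m'(1)] by blast
  next
    case (eng h1 h2)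
    then obtain W W' where W: "represents h1 W" "represents h2 W'" and h: "h1 \<in> Bij ?N" "h2 \<in> Bij ?N"
      by (auto simp: BijGroup_def)
    have "h2 u \<in> ?N" if "u \<in> ?N" for u using h(2) that by (auto dest: Bij_imp_funcset)
    from represents_comp(1)[OF W this] have "represents (h1 \<otimes>\<^bsub>?B\<^esub> h2) (\<lambda>k. substitute W' (W k))"
      by (rule represents_cong) (use h in \<open>auto simp: BijGroup_def compose_def\<close>)
    then show ?case using eng by blast
  qed
  then show "m \<in> Bij ?N" "\<exists>W. represents m W" by (auto simp: BijGroup_def)
qed

text \<open>Every choice of \<open>W\<close> gives the same matrix by
  \<open>represents_unique\<close>.\<close>

definition AC_mat :: "((nat \<Rightarrow> nat word) \<Rightarrow> (nat \<Rightarrow> nat word)) \<Rightarrow> mat" where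
  "AC_mat m = words_mat (SOME W. represents m W)"

lemma AC_mat_eq: "represents m W \<Longrightarrow> AC_mat m = words_mat W"
  unfolding AC_mat_def words_mat_def
  using represents_unique[OF someI[of "represents m" W]] by auto

lemma mat_rep_AC_group: "mat_rep (AC_group 2 F2) AC_mat"
proof -
  interpret F2: group F2 by (rule group_free_group)
  interpret G: group "AC_group 2 F2" by (rule F2.group_AC_group)
  show ?thesis
  proof
    fix g h assume gh: "g \<in> carrier (AC_group 2 F2)" "h \<in> carrier (AC_group 2 F2)"
    obtain W W' where W: "represents g W" "represents h W'"
      using AC_group_represented(2)[OF gh(1)] AC_group_represented(2)[OF gh(2)] by blast
    note B = AC_group_represented(1)[OF gh(1)] AC_group_represented(1)[OF gh(2)]
    have hN: "h u \<in> NGen 2 F2" if "u \<in> NGen 2 F2" for u using B(2) that by (auto dest: Bij_imp_funcset)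
    have "represents (g \<otimes>\<^bsub>AC_group 2 F2\<^esub> h) (\<lambda>k. substitute W' (W k))"
      by (rule represents_cong[OF represents_comp(1)[OF W hN]])
         (use B in \<open>auto simp: AC_group_def BijGroup_def compose_def\<close>)
    then show "AC_mat (g \<otimes>\<^bsub>AC_group 2 F2\<^esub> h) = mat_mult (AC_mat g) (AC_mat h)"
      using represents_comp(2)[OF W hN] W by (simp add: AC_mat_eq)
  next
    have "represents \<one>\<^bsub>AC_group 2 F2\<^esub> (\<lambda>k. [(True, k)])"
      by (auto simp: represents_def affine_letter_eq affine_letter_def eval_at_letter NGen_tuples eval_letter_def
          AC_group_def BijGroup_def)
    then show "AC_mat \<one>\<^bsub>AC_group 2 F2\<^esub> = mat_one"
      by (simp add: AC_mat_eq words_mat_def affine_letter_eq affine_letter_def mat_one_def)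
  qed
qed

section \<open>The commuting conjugates of the moves\<close>

lemma AC_movesI:
  "i \<in> {1..r} \<Longrightarrow> j \<in> {1..r} \<Longrightarrow> i \<noteq> j \<Longrightarrow> e \<in> {1, -1} \<Longrightarrow> move_R G i j e \<in> AC_moves r G"
  "i \<in> {1..r} \<Longrightarrow> j \<in> {1..r} \<Longrightarrow> i \<noteq> j \<Longrightarrow> e \<in> {1, -1} \<Longrightarrow> move_L G i j e \<in> AC_moves r G"
  "i \<in> {1..r} \<Longrightarrow> w \<in> carrier G \<Longrightarrow> move_C G i w \<in> AC_moves r G"
  unfolding AC_moves_def by blast+

lemma AC_move_in_AC_group:
  assumes "m \<in> AC_moves 2 F2" shows "restrict m (NGen 2 F2) \<in> carrier (AC_group 2 F2)"
  unfolding AC_group_def carrier_subgroup_generated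
  using group.AC_moves_Bij[OF group_free_group assms] assms by (blast intro: generate.incl)

lemma AC_group_mult_apply:
  assumes "g \<in> carrier (AC_group 2 F2)" "h \<in> carrier (AC_group 2 F2)" "u \<in> NGen 2 F2"
  shows "(g \<otimes>\<^bsub>AC_group 2 F2\<^esub> h) u = g (h u)" "h u \<in> NGen 2 F2"
  using AC_group_represented(1)[OF assms(1)] AC_group_represented(1)[OF assms(2)] assms(3)
  by (auto simp: AC_group_def BijGroup_def compose_def dest: Bij_imp_funcset)

text \<open>Conjugating \<open>u\<^sub>1 \<mapsto> u\<^sub>1 u\<^sub>2\<close> by powers of \<open>C\<^bsub>1,w\<^esub>\<close> still multiplies \<open>u\<^sub>1\<close> on the right by an element
  depending on \<open>u\<^sub>2\<close> only, so it commutes with \<open>u\<^sub>1 \<mapsto> u\<^sub>2 u\<^sub>1\<close>.\<close>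

lemma conj_moves_commute:
  fixes n :: nat
  defines "a \<equiv> restrict (move_R F2 1 2 1) (NGen 2 F2)" and "b \<equiv> restrict (move_L F2 1 2 1) (NGen 2 F2)"
  assumes w: "w \<in> carrier F2"
  defines "d \<equiv> restrict (move_C F2 1 w) (NGen 2 F2)"
  shows "d [^]\<^bsub>AC_group 2 F2\<^esub> n \<otimes>\<^bsub>AC_group 2 F2\<^esub> a \<otimes>\<^bsub>AC_group 2 F2\<^esub> inv\<^bsub>AC_group 2 F2\<^esub> d [^]\<^bsub>AC_group 2 F2\<^esub> n \<otimes>\<^bsub>AC_group 2 F2\<^esub> b
    = b \<otimes>\<^bsub>AC_group 2 F2\<^esub> (d [^]\<^bsub>AC_group 2 F2\<^esub> n \<otimes>\<^bsub>AC_group 2 F2\<^esub> a \<otimes>\<^bsub>AC_group 2 F2\<^esub> inv\<^bsub>AC_group 2 F2\<^esub> d [^]\<^bsub>AC_group 2 F2\<^esub> n)"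
proof -
  interpret F2: group F2 by (rule group_free_group)
  interpret G: group "AC_group 2 F2" by (rule F2.group_AC_group)
  let ?G = "AC_group 2 F2"
  have "move_R F2 1 2 1 \<in> AC_moves 2 F2" "move_L F2 1 2 1 \<in> AC_moves 2 F2" "move_C F2 1 w \<in> AC_moves 2 F2"
    using w by (auto intro!: AC_movesI)
  then have abd: "a \<in> carrier ?G" "b \<in> carrier ?G" "d \<in> carrier ?G"
    unfolding a_def b_def d_def by (blast intro: AC_move_in_AC_group)+
  have u: "u 1 \<in> carrier F2" "u 2 \<in> carrier F2" if "u \<in> NGen 2 F2" for u
    using NGen_tuples[OF that] by (auto simp: tuples_def)
  define x where "x n = d [^]\<^bsub>?G\<^esub> n \<otimes>\<^bsub>?G\<^esub> a \<otimes>\<^bsub>?G\<^esub> inv\<^bsub>?G\<^esub> d [^]\<^bsub>?G\<^esub> n" for n :: nat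
  have x: "x n \<in> carrier ?G" for n using abd by (simp add: x_def)
  \<comment> \<open>One more conjugation by \<open>d\<close> replaces the multiplier
    \<open>f\<close> by its conjugate by \<open>w\<close>, which still depends on the second entry
    only.\<close>
  have shear: "\<exists>f. (\<forall>v\<in>carrier F2. f v \<in> carrier F2) \<and> (\<forall>u\<in>NGen 2 F2. x n u = u(1 := u 1 \<otimes>\<^bsub>F2\<^esub> f (u 2)))"
  proof (induction n)
    case 0
    have "x 0 = a" using abd by (simp add: x_def)
    then show ?case using u by (intro exI[of _ "\<lambda>v. v"]) (simp add: a_def move_R_def F2.int_pow_1 del: mult_free_group)
  next
    case (Suc n)
    then obtain f where f: "\<And>v. v \<in> carrier F2 \<Longrightarrow> f v \<in> carrier F2"
      "\<And>u. u \<in> NGen 2 F2 \<Longrightarrow> x n u = u(1 := u 1 \<otimes>\<^bsub>F2\<^esub> f (u 2))" by blast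
    let ?d' = "inv\<^bsub>?G\<^esub> d"
    have d': "?d' \<in> carrier ?G" using abd by simp
    have "x (Suc n) = d \<otimes>\<^bsub>?G\<^esub> (x n \<otimes>\<^bsub>?G\<^esub> ?d')"
    proof -
      have "d [^]\<^bsub>?G\<^esub> Suc n = d \<otimes>\<^bsub>?G\<^esub> d [^]\<^bsub>?G\<^esub> n" by (rule G.nat_pow_Suc2[OF abd(3)])
      moreover have "?d' [^]\<^bsub>?G\<^esub> Suc n = ?d' [^]\<^bsub>?G\<^esub> n \<otimes>\<^bsub>?G\<^esub> ?d'" by simp
      ultimately show ?thesis using abd by (simp only: x_def) (simp add: G.m_assoc)
    qed
    moreover have "(d \<otimes>\<^bsub>?G\<^esub> (x n \<otimes>\<^bsub>?G\<^esub> ?d')) u = u(1 := u 1 \<otimes>\<^bsub>F2\<^esub> (w \<otimes>\<^bsub>F2\<^esub> f (u 2) \<otimes>\<^bsub>F2\<^esub> inv\<^bsub>F2\<^esub> w))"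
      if uN: "u \<in> NGen 2 F2" for u
    proof -
      define v where "v = ?d' u"
      have v: "v \<in> NGen 2 F2" using AC_group_mult_apply(2)[OF abd(3) d' uN] by (simp add: v_def)
      have "\<one>\<^bsub>?G\<^esub> u = u" using uN by (simp add: AC_group_def BijGroup_def)
      then have "d v = u" using AC_group_mult_apply(1)[OF abd(3) d' uN] abd by (simp add: v_def)
      then have u_eq: "u = v(1 := w \<otimes>\<^bsub>F2\<^esub> v 1 \<otimes>\<^bsub>F2\<^esub> inv\<^bsub>F2\<^esub> w)" using v by (simp add: d_def move_C_def del: mult_free_group)
      have xv: "x n v \<in> NGen 2 F2" using AC_group_mult_apply(2)[OF abd(3) x v] .
      have fv: "f (v 2) \<in> carrier F2" by (rule f(1)[OF u(2)[OF v]])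
      have "(d \<otimes>\<^bsub>?G\<^esub> (x n \<otimes>\<^bsub>?G\<^esub> ?d')) u = d (x n v)"
        using AC_group_mult_apply(1)[OF abd(3) G.m_closed[OF x d'] uN] AC_group_mult_apply(1)[OF x d' uN] by (simp add: v_def)
      also have "\<dots> = v(1 := w \<otimes>\<^bsub>F2\<^esub> (v 1 \<otimes>\<^bsub>F2\<^esub> f (v 2)) \<otimes>\<^bsub>F2\<^esub> inv\<^bsub>F2\<^esub> w)"
        using xv f(2)[OF v] by (simp add: d_def move_C_def del: mult_free_group)
      also have "w \<otimes>\<^bsub>F2\<^esub> (v 1 \<otimes>\<^bsub>F2\<^esub> f (v 2)) \<otimes>\<^bsub>F2\<^esub> inv\<^bsub>F2\<^esub> w
          = (w \<otimes>\<^bsub>F2\<^esub> v 1 \<otimes>\<^bsub>F2\<^esub> inv\<^bsub>F2\<^esub> w) \<otimes>\<^bsub>F2\<^esub> (w \<otimes>\<^bsub>F2\<^esub> f (v 2) \<otimes>\<^bsub>F2\<^esub> inv\<^bsub>F2\<^esub> w)"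
      proof -
        have "inv\<^bsub>F2\<^esub> w \<otimes>\<^bsub>F2\<^esub> (w \<otimes>\<^bsub>F2\<^esub> y) = y" if "y \<in> carrier F2" for y
          using w that by (simp flip: F2.m_assoc del: mult_free_group one_free_group)
        then show ?thesis using w fv u(1)[OF v] by (simp add: F2.m_assoc del: mult_free_group)
      qed
      finally have "(d \<otimes>\<^bsub>?G\<^esub> (x n \<otimes>\<^bsub>?G\<^esub> ?d')) u = v(1 := (w \<otimes>\<^bsub>F2\<^esub> v 1 \<otimes>\<^bsub>F2\<^esub> inv\<^bsub>F2\<^esub> w) \<otimes>\<^bsub>F2\<^esub> (w \<otimes>\<^bsub>F2\<^esub> f (v 2) \<otimes>\<^bsub>F2\<^esub> inv\<^bsub>F2\<^esub> w))" .
      moreover have "u 1 = w \<otimes>\<^bsub>F2\<^esub> v 1 \<otimes>\<^bsub>F2\<^esub> inv\<^bsub>F2\<^esub> w" "u 2 = v 2"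
        by (subst u_eq, simp del: mult_free_group)+
      moreover have "u(1 := z) = v(1 := z)" for z
        by (subst u_eq) (rule fun_upd_upd)
      ultimately show ?thesis by (simp only:)
    qed
    ultimately show ?case
      using f(1) w by (intro exI[of _ "\<lambda>v. w \<otimes>\<^bsub>F2\<^esub> f v \<otimes>\<^bsub>F2\<^esub> inv\<^bsub>F2\<^esub> w"]) (simp del: mult_free_group)
  qed
  then obtain f where f: "\<And>v. v \<in> carrier F2 \<Longrightarrow> f v \<in> carrier F2"
    "\<And>u. u \<in> NGen 2 F2 \<Longrightarrow> x n u = u(1 := u 1 \<otimes>\<^bsub>F2\<^esub> f (u 2))" by blast
  have "(x n \<otimes>\<^bsub>?G\<^esub> b) v = (b \<otimes>\<^bsub>?G\<^esub> x n) v" if v: "v \<in> NGen 2 F2" for v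
  proof -
    have b: "b y = y(1 := y 2 \<otimes>\<^bsub>F2\<^esub> y 1)" if "y \<in> NGen 2 F2" for y
      using that u[OF that] by (simp add: b_def move_L_def F2.int_pow_1 del: mult_free_group)
    have bv: "b v \<in> NGen 2 F2" and xv: "x n v \<in> NGen 2 F2"
      using AC_group_mult_apply(2)[OF abd(3) abd(2) v] AC_group_mult_apply(2)[OF abd(3) x v] .
    have "x n (b v) = b (x n v)"
      using f(2)[OF bv] b[OF xv] b[OF v] f(2)[OF v] f(1)[OF u(2)[OF v]] u[OF v]
      by (simp add: F2.m_assoc del: mult_free_group)
    then show ?thesis
      using AC_group_mult_apply(1)[OF x abd(2) v] AC_group_mult_apply(1)[OF abd(2) x v] by simp
  qed
  \<comment> \<open>Agreement on \<open>NGen 2 F2\<close> suffices, since elements of the group are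
    extensional.\<close>
  moreover have "x n \<otimes>\<^bsub>?G\<^esub> b \<in> extensional (NGen 2 F2)" "b \<otimes>\<^bsub>?G\<^esub> x n \<in> extensional (NGen 2 F2)"
    using AC_group_represented(1) G.m_closed[OF x abd(2)] G.m_closed[OF abd(2) x] by (auto dest: Bij_imp_extensional)
  ultimately have "x n \<otimes>\<^bsub>?G\<^esub> b = b \<otimes>\<^bsub>?G\<^esub> x n" by (rule extensionalityI[rotated 2])
  then show ?thesis by (simp add: x_def)
qed

theorem corollaryC:
  shows "\<not> finitely_presentable (AC_group 2 (free_group {1..2::nat}))"
proof -
  interpret F4: group F4 by (rule group_free_group)
  interpret AC: mat_rep "AC_group 2 F2" AC_mat by (rule mat_rep_AC_group)
  \<comment> \<open>This is \<open>y\<^sub>1\<close>, which \<open>affine\<close> sends to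
    \<open>t\<close>; conjugating the first entry by it becomes the diagonal matrix with entries
    \<open>t\<close> and 1.\<close>
  let ?y = "[(True, 1)] :: nat word"
  have y: "?y \<in> carrier F2" by simp
  have in_G: "restrict (move_R F2 1 2 1) (NGen 2 F2) \<in> carrier (AC_group 2 F2)"
    "restrict (move_L F2 1 2 1) (NGen 2 F2) \<in> carrier (AC_group 2 F2)"
    "restrict (move_C F2 1 ?y) (NGen 2 F2) \<in> carrier (AC_group 2 F2)"
    using y by (auto intro!: AC_move_in_AC_group AC_movesI)
  have mat: "AC_mat (restrict m (NGen 2 F2)) = words_mat W" if "represents m W" for m W
    by (rule AC_mat_eq[OF represents_cong[OF that]]) simp
  \<comment> \<open>Right and left multiplication by the second entry agree after abelianisation, so
    both moves get the same matrix.\<close>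
  have "AC_mat (restrict (move_R F2 1 2 1) (NGen 2 F2)) = AC.affine_mat 0 1"
    by (subst mat[OF represents_R]) (simp_all add: words_mat_def inv_letter_def affine_def free_lift_def affine_letter_def affine_group_def AC.affine_mat_def)
  moreover have "AC_mat (restrict (move_L F2 1 2 1) (NGen 2 F2)) = AC.affine_mat 0 1"
    by (subst mat[OF represents_L]) (simp_all add: words_mat_def inv_letter_def affine_def free_lift_def affine_letter_def affine_group_def AC.affine_mat_def)
  moreover have "AC_mat (restrict (move_C F2 1 ?y) (NGen 2 F2)) = AC.affine_mat 1 0"
  proof -
    have "foldr push (foldr push (embed ?y) [(True, 1)]) (inv\<^bsub>F4\<^esub> (embed ?y)) = [(True, 3), (True, 1), (False, 3)]"
      by (simp add: embed_letter inv_free_group_letter inv_letter_def)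
    moreover have "affine [(True, 3), (True, 1), (False, 3)] = ((tpow 1, 0), 0)"
      by (simp add: affine_def free_lift_def affine_letter_def affine_inv) (simp add: affine_group_def)
    ultimately show ?thesis
      by (subst mat[OF represents_C[OF _ y]]) (simp_all add: words_mat_def affine_letter_eq affine_letter_def AC.affine_mat_def)
  qed
  ultimately show ?thesis
    using AC.not_finitely_presentable[OF in_G(1) _ in_G(2) _ in_G(3) _ conj_moves_commute[OF y]] by blast
qed

end
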